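(* Let $m$ be an integer with $m\ge 2$. Then there exists $n_0=n_0(m)$ such that for every integer $n\ge n_0$, $$\hat r_{\mathrm{edge}}(B_{m,n}^{\prec})\le (2m^2+m2^{m+2})n^2-mn .$$
   Context: All graphs are finite, simple and undirected. An edge-ordered graph $G^{\prec}$ is a pair $(G,\prec)$ of a graph $G$ and a linear order $\prec$ on $E(G)$. $G^{\prec}$ is an edge-ordered subgraph of $H^{\prec}$ if $G$ is a subgraph of $H$ and the edge order of $G$ is the restriction of the edge order of $H$. Two edge-ordered graphs are isomorphic if there is a graph isomorphism whose induced map on edges preserves the edge orders. An edge-ordered copy of $G^{\prec}$ in $F^{\prec}$ is an edge-ordered subgraph of $F^{\prec}$ isomorphic to $G^{\prec}$. For edge-ordered graphs $G^{\prec},H^{\prec}$, the size edge-ordered Ramsey number $\hat r_{\mathrm{edge}}(G^{\prec},H^{\prec})$ is the minimum number $N$ such that there exists an edge-ordered graph $F^{\prec}$ with $N$ edges such that every red/blue coloring of the edges of $F^{\prec}$ contains a red edge-ordered copy of $G^{\prec}$ or a blue edge-ordered copy of $H^{\prec}$. Write $\hat r_{\mathrm{edge}}(G^{\prec})=\hat r_{\mathrm{edge}}(G^{\prec},G^{\prec})$. The book graph $B_{m,n}$ is obtained by taking $n$ copies of $K_{m+1}$ and identifying them along a common $K_m$ (the spine); the remaining $n$ vertices, which are pairwise non-adjacent, are the pages. Let the spine vertices be $u_1,\dots,u_m$ and the page vertices $v_1,\dots,v_n$. The edge-ordered book graph $B_{m,n}^{\prec}$ is $B_{m,n}$ with the following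 edge order: for spine edges $u_iu_j$ ($1\le i<j\le m$) and $u_su_t$ ($1\le s<t\le m$), $u_iu_j\prec u_su_t$ iff $i<s$, or $i=s$ and $j<t$; every spine edge precedes every page-spine edge; and for page-spine edges, $v_iu_j\prec v_su_t$ iff $i<s$, or $i=s$ and $j<t$ (here $1\le i,s\le n$ and $1\le j,t\le m$). *)

theory Defs
  imports "HOL-Library.Ramsey" "HOL-Library.Extended_Nat"
begin

text \<open>
  Edges are two-element sets of vertices, and the edge order is the strict relation, given as a set
  of pairs.  The library predicate \<open>strict_linear_order_on\<close> does not confine a relation to its
  carrier, so this is required separately.
\<close>

record 'a eograph =
  verts :: "'a set"
  edges :: "'a set set"
  eless :: "'a set rel"

definition edge_ordered_graph :: "'a eograph \<Rightarrow> bool" where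
  "edge_ordered_graph G \<longleftrightarrow>
     finite (verts G) \<and> edges G \<subseteq> [verts G]\<^bsup>2\<^esup> \<and>
     eless G \<subseteq> edges G \<times> edges G \<and> strict_linear_order_on (edges G) (eless G)"

definition eo_subgraph :: "'a eograph \<Rightarrow> 'a eograph \<Rightarrow> bool" where
  "eo_subgraph G H \<longleftrightarrow>
     edge_ordered_graph G \<and> edge_ordered_graph H \<and>
     verts G \<subseteq> verts H \<and> edges G \<subseteq> edges H \<and> eless G = Restr (eless H) (edges G)"

definition eo_iso :: "'a eograph \<Rightarrow> 'b eograph \<Rightarrow> bool" where
  "eo_iso G H \<longleftrightarrow>
     (\<exists>f. bij_betw f (verts G) (verts H) \<and>
          (\<forall>u\<in>verts G. \<forall>v\<in>verts G. {u, v} \<in> edges G \<longleftrightarrow> {f u, f v} \<in> edges H) \<and>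
          (\<forall>e\<in>edges G. \<forall>e'\<in>edges G. (e, e') \<in> eless G \<longleftrightarrow> (f ` e, f ` e') \<in> eless H))"

definition eo_copy :: "'a eograph \<Rightarrow> 'b eograph \<Rightarrow> 'b eograph \<Rightarrow> bool" where
  "eo_copy G F C \<longleftrightarrow> eo_subgraph C F \<and> eo_iso C G"

datatype colour = Red | Blue

definition eo_arrows :: "'c eograph \<Rightarrow> 'a eograph \<Rightarrow> 'b eograph \<Rightarrow> bool" where
  "eo_arrows F G H \<longleftrightarrow>
     (\<forall>c :: 'c set \<Rightarrow> colour.
        (\<exists>C. eo_copy G F C \<and> (\<forall>e\<in>edges C. c e = Red)) \<or>
        (\<exists>C. eo_copy H F C \<and> (\<forall>e\<in>edges C. c e = Blue)))"

text \<open>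
  The host graph \<open>F\<close> ranges over graphs on natural numbers; every finite edge-ordered graph is
  isomorphic to one of these.  The minimum is taken in \<^typ>\<open>enat\<close>, where the infimum of the empty
  set is \<open>\<infinity>\<close>, so that a finite upper bound includes the existence of a suitable \<open>F\<close>.
\<close>

definition size_eo_ramsey :: "'a eograph \<Rightarrow> 'b eograph \<Rightarrow> enat" where
  "size_eo_ramsey G H =
     Inf {enat N | N. \<exists>F :: nat eograph.
                        edge_ordered_graph F \<and> card (edges F) = N \<and> eo_arrows F G H}"

abbreviation size_eo_ramsey_diag :: "'a eograph \<Rightarrow> enat" where
  "size_eo_ramsey_diag G \<equiv> size_eo_ramsey G G"

datatype book_vertex = Spine nat | Page nat

text \<open>
  The three parts of the order compare spine edges with spine edges, spine edges with page-spine
  edges, and page-spine edges with page-spine edges.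
\<close>

definition book :: "nat \<Rightarrow> nat \<Rightarrow> book_vertex eograph" where
  "book m n =
     \<lparr>verts = Spine ` {1..m} \<union> Page ` {1..n},
      edges = {{Spine i, Spine j} | i j. 1 \<le> i \<and> i < j \<and> j \<le> m} \<union>
              {{Page i, Spine j} | i j. i \<in> {1..n} \<and> j \<in> {1..m}},
      eless = {({Spine i, Spine j}, {Spine s, Spine t}) | i j s t.
                 1 \<le> i \<and> i < j \<and> j \<le> m \<and> 1 \<le> s \<and> s < t \<and> t \<le> m \<and>
                 (i < s \<or> i = s \<and> j < t)} \<union>
              {({Spine i, Spine j}, {Page s, Spine t}) | i j s t.
                 1 \<le> i \<and> i < j \<and> j \<le> m \<and> s \<in> {1..n} \<and> t \<in> {1..m}} \<union>
              {({Page i, Spine j}, {Page s, Spine t}) | i j s t.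
                 i \<in> {1..n} \<and> j \<in> {1..m} \<and> s \<in> {1..n} \<and> t \<in> {1..m} \<and>
                 (i < s \<or> i = s \<and> j < t)}\<rparr>"

lemma eless_book_spine_spine:
  assumes "1 \<le> i" "i < j" "j \<le> m" "1 \<le> s" "s < t" "t \<le> m" "i < s \<or> i = s \<and> j < t"
  shows "({Spine i, Spine j}, {Spine s, Spine t}) \<in> eless (book m n)"
  unfolding book_def eograph.simps
  by (intro UnI1 CollectI exI conjI, rule refl) (use assms in simp_all)

lemma eless_book_spine_page:
  assumes "1 \<le> i" "i < j" "j \<le> m" "s \<in> {1..n}" "t \<in> {1..m}"
  shows "({Spine i, Spine j}, {Page s, Spine t}) \<in> eless (book m n)"
  unfolding book_def eograph.simps
  by (rule UnI1, rule UnI2, intro CollectI exI conjI, rule refl) (use assms in simp_all)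

lemma eless_book_page_page:
  assumes "i \<in> {1..n}" "j \<in> {1..m}" "s \<in> {1..n}" "t \<in> {1..m}" "i < s \<or> i = s \<and> j < t"
  shows "({Page i, Spine j}, {Page s, Spine t}) \<in> eless (book m n)"
  unfolding book_def eograph.simps
  by (rule UnI2, intro CollectI exI conjI, rule refl) (use assms in simp_all)

lemma edge_ordered_graph_book: "edge_ordered_graph (book m n)"
proof -
  have "finite (verts (book m n))"
    by (simp add: book_def)
  moreover have "edges (book m n) \<subseteq> [verts (book m n)]\<^bsup>2\<^esup>"
    by (auto simp: book_def nsets_def card_insert_if)
  moreover have "eless (book m n) \<subseteq> edges (book m n) \<times> edges (book m n)"
    by (auto simp: book_def)
  moreover have "irrefl (eless (book m n))"
    by (auto simp: irrefl_def book_def doubleton_eq_iff)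
  moreover have "trans (eless (book m n))"
    by (rule transI) (auto simp: book_def doubleton_eq_iff)
  moreover have "total_on (edges (book m n)) (eless (book m n))"
    unfolding total_on_def
  proof (intro ballI impI)
    fix e e' assume e: "e \<in> edges (book m n)" and e': "e' \<in> edges (book m n)" and ne: "e \<noteq> e'"
    from e consider
        (s) i j where "e = {Spine i, Spine j}" "1 \<le> i" "i < j" "j \<le> m"
      | (p) i j where "e = {Page i, Spine j}" "i \<in> {1..n}" "j \<in> {1..m}"
      by (auto simp: book_def)
    note ce = this
    from e' consider
        (s') s t where "e' = {Spine s, Spine t}" "1 \<le> s" "s < t" "t \<le> m"
      | (p') s t where "e' = {Page s, Spine t}" "s \<in> {1..n}" "t \<in> {1..m}"
      by (auto simp: book_def)
    note ce' = this
    show "(e, e') \<in> eless (book m n) \<or> (e', e) \<in> eless (book m n)"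
    proof (cases rule: ce)
      case (s i j)
      show ?thesis
      proof (cases rule: ce')
        case (s' a b)
        with s ne have "(i < a \<or> i = a \<and> j < b) \<or> (a < i \<or> a = i \<and> b < j)"
          by auto
        with s s' show ?thesis by (metis eless_book_spine_spine)
      next
        case (p' a b)
        with s show ?thesis by (metis eless_book_spine_page)
      qed
    next
      case (p i j)
      show ?thesis
      proof (cases rule: ce')
        case (s' a b)
        with p show ?thesis by (metis eless_book_spine_page)
      next
        case (p' a b)
        with p ne have "(i < a \<or> i = a \<and> j < b) \<or> (a < i \<or> a = i \<and> b < j)"
          by auto
        with p p' show ?thesis by (metis eless_book_page_page)
      qed
    qed
  qed
  ultimately show ?thesis
    by (simp add: edge_ordered_graph_def strict_linear_order_on_def)
qed

end

theory Submission
  imports Defs Complex_Main "HOL-Library.Product_Lexorder"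
begin

text \<open>
  The host consists of a complete graph on \<open>M = 2mn\<close> spine vertices together with \<open>N = 2\<^sup>m\<^sup>+\<^sup>1 n\<close>
  page vertices, each joined to the whole spine; its number of edges is exactly the claimed bound.
  The spine is cut into boundedly many intervals, called blocks.  Edges inside the spine are
  grouped by the pair of blocks that they meet, and these pairs are ordered lexicographically.
  Inside a block the edges are ordered lexicographically too, but edges between two different
  blocks are ordered by the endpoint in the \<^emph>\<open>later\<close> block first.  Edges to the page vertices come
  last and are ordered by the page vertex first.  This order makes three kinds of books
  order-correct: the spine of the copy may lie in one block, with its pages among the page vertices
  or in later blocks, or it may have its vertices in pairwise different blocks, with its pages among
  the page vertices.

  Suppose that a colouring contains no monochromatic ordered copy of the book.  By Ramsey's
  theorem one of the colours, say red, has the following property on a set \<open>A\<close> of at least \<open>mn\<close>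
  spine vertices (\<open>ex_clique_rich_half\<close>): every subset of \<open>A\<close> of linear size contains a large red
  clique inside one block.  Since \<open>m\<close> vertices of a red clique have fewer than \<open>n\<close> common red
  neighbours in later blocks, choosing a red clique costs only slightly more than \<open>n\<close> vertices of
  \<open>A\<close>: most of the others send blue edges to a positive fraction of the clique.  So there
  is room for \<open>m\<close> red cliques \<open>Q\<^sub>1, \<dots>, Q\<^sub>m\<close> of any prescribed constant size, in different blocks,
  with all edges between them blue (\<open>clique_chain\<close>).

  Finally let \<open>r\<^sub>i\<close> be the density of red edges from a page vertex to \<open>Q\<^sub>i\<close>.  A random \<open>m\<close>-tuple in
  \<open>Q\<^sub>i\<close> is essentially a red \<open>K\<^sub>m\<close>, and a random transversal of the cliques is a blue \<open>K\<^sub>m\<close>.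
  Neither has \<open>n\<close> common neighbours in its own colour, so the sum of
  \<open>(\<Sum>i. r\<^sub>i\<^sup>m) / m + (\<Prod>i. 1 - r\<^sub>i)\<close> over all page vertices is at most \<open>2n\<close>, up to a small error.
  But this expression is always at least \<open>9/8\<close> times \<open>2\<^sup>-\<^sup>m\<close>, and there are \<open>2\<^sup>m\<^sup>+\<^sup>1 n\<close> page vertices
  (\<open>card_less_if_few_common_neighbours\<close>).
\<close>

section \<open>The host graph\<close>

text \<open>
  Order preservation is required in one direction only: the order of \<open>G\<close> is total and that of \<open>F\<close> is
  irreflexive and transitive, so the converse follows.
\<close>

lemma eo_copy_of_embedding:
  assumes G: "edge_ordered_graph G" and F: "edge_ordered_graph F"
    and inj: "inj_on f (verts G)" and V: "f ` verts G \<subseteq> verts F"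
    and E: "\<And>e. e \<in> edges G \<Longrightarrow> f ` e \<in> edges F"
    and less: "\<And>e e'. (e, e') \<in> eless G \<Longrightarrow> (f ` e, f ` e') \<in> eless F"
  shows "\<exists>C. eo_copy G F C \<and> edges C = (\<lambda>e. f ` e) ` edges G"
proof -
  let ?E = "(\<lambda>e. f ` e) ` edges G"
  let ?g = "inv_into (verts G) f"
  define C where "C = \<lparr>verts = f ` verts G, edges = ?E, eless = Restr (eless F) ?E\<rparr>"
  have simps: "verts C = f ` verts G" "edges C = ?E" "eless C = Restr (eless F) ?E"
    by (simp_all add: C_def)
  have sub: "e \<subseteq> verts G" if "e \<in> edges G" for e
    using G that by (auto simp: edge_ordered_graph_def nsets_def)
  have inv_img: "?g ` f ` e = e" if "e \<subseteq> verts G" for e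
    using inv_into_image_cancel[OF inj that] .
  have "?E \<subseteq> [f ` verts G]\<^bsup>2\<^esup>"
  proof
    fix e assume "e \<in> ?E"
    then obtain d where d: "d \<in> edges G" "e = f ` d" by blast
    have "d \<in> [verts G]\<^bsup>2\<^esup>" using G d by (auto simp: edge_ordered_graph_def)
    then show "e \<in> [f ` verts G]\<^bsup>2\<^esup>"
      using inj d(2) by (auto simp: nsets_def card_image inj_on_subset)
  qed
  moreover have "strict_linear_order_on ?E (Restr (eless F) ?E)"
  proof -
    have EF: "?E \<subseteq> edges F" using E by blast
    have "strict_linear_order_on (edges F) (eless F)"
      using F by (simp add: edge_ordered_graph_def)
    then have "trans (eless F)" "irrefl (eless F)" "total_on (edges F) (eless F)"
      by (auto simp: strict_linear_order_on_def)
    then have "trans (Restr (eless F) ?E)" "irrefl (Restr (eless F) ?E)" "total_on ?E (Restr (eless F) ?E)"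
      using EF by (auto simp: irrefl_def total_on_def subset_iff intro: trans_Restr)
    then show ?thesis by (simp add: strict_linear_order_on_def)
  qed
  ultimately have C: "edge_ordered_graph C"
    using G by (auto simp: edge_ordered_graph_def simps)
  then have "eo_subgraph C F"
    using F V E by (auto simp: eo_subgraph_def simps)
  moreover have "eo_iso C G"
    unfolding eo_iso_def simps
  proof (intro exI[of _ ?g] conjI ballI)
    show "bij_betw ?g (f ` verts G) (verts G)"
      using inj by (simp add: bij_betw_inv_into inj_on_imp_bij_betw)
  next
    fix u v assume "u \<in> f ` verts G" "v \<in> f ` verts G"
    then obtain x y where x: "x \<in> verts G" "u = f x" and y: "y \<in> verts G" "v = f y"
      by blast
    have "f ` {x, y} \<in> ?E \<longleftrightarrow> {x, y} \<in> edges G"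
    proof
      assume "f ` {x, y} \<in> ?E"
      then obtain d where d: "d \<in> edges G" "f ` {x, y} = f ` d" by blast
      moreover have "{x, y} \<subseteq> verts G" using x y by simp
      ultimately have "{x, y} = d" using inj_on_image_eq_iff[OF inj _ sub] by blast
      then show "{x, y} \<in> edges G" using d by simp
    qed (rule imageI)
    then show "{u, v} \<in> ?E \<longleftrightarrow> {?g u, ?g v} \<in> edges G"
      using x y inj by simp
  next
    fix e e' assume "e \<in> ?E" "e' \<in> ?E"
    then obtain d d' where d: "d \<in> edges G" "e = f ` d" and d': "d' \<in> edges G" "e' = f ` d'"
      by blast
    have "(f ` d, f ` d') \<in> eless F \<longleftrightarrow> (d, d') \<in> eless G"
    proof
      assume a: "(f ` d, f ` d') \<in> eless F"
      have "irrefl (eless F)" "trans (eless F)" "total_on (edges G) (eless G)"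
        using F G by (auto simp: edge_ordered_graph_def strict_linear_order_on_def)
      then show "(d, d') \<in> eless G"
        using a less d(1) d'(1) unfolding irrefl_def trans_def total_on_def by metis
    qed (rule less)
    moreover have "?g ` e = d" "?g ` e' = d'"
      using d d' sub inv_img by simp_all
    ultimately show "(e, e') \<in> Restr (eless F) ?E \<longleftrightarrow> (?g ` e, ?g ` e') \<in> eless G"
      using d d' by simp
  qed
  ultimately show ?thesis
    by (auto simp: eo_copy_def simps)
qed

text \<open>
  The spine vertices are the numbers below \<open>M\<close>, the page vertices those from \<open>M\<close> on, and the block of
  \<open>x\<close> is \<open>x div L\<close>.  Keys are compared lexicographically.  As \<open>x div L < M\<close> for every spine vertex, the
  first component \<open>M\<close> puts the edges at the page vertices behind all others.
\<close>

definition edge_key :: "nat \<Rightarrow> nat \<Rightarrow> nat set \<Rightarrow> nat \<times> nat \<times> nat \<times> nat" where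
  "edge_key L M e =
     (let x = Min e; y = Max e in
      if M \<le> y then (M, 0, y, x)
      else if x div L = y div L then (x div L, x div L, x, y)
      else (x div L, y div L, y, x))"

definition host :: "nat \<Rightarrow> nat \<Rightarrow> nat \<Rightarrow> nat eograph" where
  "host L M N =
     (let E = {{x, y} | x y. x < y \<and> x < M \<and> y < M + N} in
      \<lparr>verts = {..<M + N}, edges = E,
       eless = {(e, e'). e \<in> E \<and> e' \<in> E \<and> edge_key L M e < edge_key L M e'}\<rparr>)"

lemma host_simps:
  "verts (host L M N) = {..<M + N}"
  "edges (host L M N) = {{x, y} | x y. x < y \<and> x < M \<and> y < M + N}"
  "(e, e') \<in> eless (host L M N) \<longleftrightarrow>
     e \<in> edges (host L M N) \<and> e' \<in> edges (host L M N) \<and> edge_key L M e < edge_key L M e'"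
  by (auto simp: host_def Let_def)

lemma edge_key_doubleton:
  assumes "x < y"
  shows "edge_key L M {x, y} =
     (if M \<le> y then (M, 0, y, x)
      else if x div L = y div L then (x div L, x div L, x, y)
      else (x div L, y div L, y, x))"
  using assms by (simp add: edge_key_def max_def min_def)

lemma edge_ordered_graph_host: "edge_ordered_graph (host L M N)"
proof -
  have div_less: "x div L < M" if "x < M" for x
    using that div_le_dividend[of x L] by linarith
  have inj: "inj_on (edge_key L M) (edges (host L M N))"
  proof (rule inj_onI)
    fix e e' assume "e \<in> edges (host L M N)" "e' \<in> edges (host L M N)"
      and eq: "edge_key L M e = edge_key L M e'"
    then obtain x y s t where e: "e = {x, y}" "x < y" "x < M" and e': "e' = {s, t}" "s < t" "s < M"
      by (auto simp: host_simps)
    have "x = s \<and> y = t"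
      using eq e e' div_less[of x] div_less[of s]
      by (auto simp: edge_key_doubleton split: if_splits)
    then show "e = e'" using e e' by simp
  qed
  have "edges (host L M N) \<subseteq> [verts (host L M N)]\<^bsup>2\<^esup>"
    by (auto simp: host_simps nsets_def card_insert_if)
  moreover have "eless (host L M N) \<subseteq> edges (host L M N) \<times> edges (host L M N)"
    by (auto simp: host_simps(3))
  moreover have "strict_linear_order_on (edges (host L M N)) (eless (host L M N))"
    unfolding strict_linear_order_on_def
  proof (intro conjI)
    show "trans (eless (host L M N))"
      by (rule transI) (auto simp: host_simps(3) intro: less_trans)
    show "irrefl (eless (host L M N))"
      by (auto simp: irrefl_def host_simps(3))
    show "total_on (edges (host L M N)) (eless (host L M N))"
      unfolding total_on_def host_simps(3) using inj by (metis inj_on_def linorder_less_linear)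
  qed
  ultimately show ?thesis
    by (simp add: edge_ordered_graph_def host_simps(1))
qed

lemma card_edges_host: "card (edges (host L M N)) = M * (M - 1) div 2 + M * N"
proof -
  let ?A = "[{..<M}]\<^bsup>2\<^esup>" and ?B = "(\<lambda>(x, y). {x, y}) ` ({..<M} \<times> {M..<M + N})"
  have "edges (host L M N) = ?A \<union> ?B"
  proof (intro equalityI subsetI)
    fix e assume "e \<in> edges (host L M N)"
    then obtain x y where e: "e = {x, y}" "x < y" "x < M" "y < M + N"
      by (auto simp: host_simps)
    then have "e \<in> ?A" if "y < M"
      using that by (auto simp: nsets_def card_insert_if)
    moreover have "e \<in> ?B" if "\<not> y < M"
      using that e by (intro image_eqI[of _ _ "(x, y)"]) auto
    ultimately show "e \<in> ?A \<union> ?B" by blast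
  next
    fix e assume "e \<in> ?A \<union> ?B"
    then show "e \<in> edges (host L M N)"
    proof
      assume "e \<in> ?A"
      then obtain x y where "e = {x, y}" "x \<noteq> y" "x < M" "y < M"
        by (auto simp: nsets_def card_2_iff)
      then show ?thesis
        unfolding host_simps(2) mem_Collect_eq
        by (metis insert_commute linorder_neqE_nat trans_less_add1)
    next
      assume "e \<in> ?B"
      then obtain x y where "e = {x, y}" "x < M" "M \<le> y" "y < M + N" by auto
      then show ?thesis unfolding host_simps(2) mem_Collect_eq by (metis order_less_le_trans)
    qed
  qed
  moreover have "?A \<inter> ?B = {}"
    by (auto simp: nsets_def)
  moreover have "finite ?A" "card ?A = M choose 2"
    by (simp_all add: finite_imp_finite_nsets card_nsets)
  moreover have "card ?B = M * N"
    by (subst card_image) (auto simp: inj_on_def doubleton_eq_iff)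
  ultimately show ?thesis
    by (simp add: card_Un_disjoint choose_two)
qed

section \<open>Monochromatic books in the host\<close>

definition same_block :: "(nat \<Rightarrow> nat) \<Rightarrow> nat set \<Rightarrow> bool" where
  "same_block b S \<longleftrightarrow> (\<forall>x\<in>S. \<forall>y\<in>S. b x = b y)"

lemma same_block_subset: "same_block b S \<Longrightarrow> S' \<subseteq> S \<Longrightarrow> same_block b S'"
  unfolding same_block_def by blast

text \<open>
  In the key of an edge between two blocks the endpoint in the later block comes first.  Hence the
  edges from a spine inside one block to pages in later blocks are sorted page by page, as the book
  demands, and they follow the edges inside the block.  If instead the spine vertices lie in
  different blocks, then the two block indices alone already sort the spine edges lexicographically.
\<close>

lemma monochromatic_book_in_host:
  fixes c :: "nat set \<Rightarrow> colour"
  assumes S: "S \<subseteq> {..<M}" "card S = m" and W: "W \<subseteq> {..<M + N}" "n \<le> card W"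
    and blocks: "same_block (\<lambda>x. x div L) S \<or> inj_on (\<lambda>x. x div L) S"
    and pages: "(\<forall>w\<in>W. M \<le> w) \<or>
      same_block (\<lambda>x. x div L) S \<and> (\<forall>w\<in>W. w < M \<and> (\<forall>x\<in>S. x div L < w div L))"
    and spine_col: "clique S {e. c e = a}" and page_col: "\<forall>x\<in>S. \<forall>w\<in>W. c {x, w} = a"
  shows "\<exists>C. eo_copy (book m n) (host L M N) C \<and> (\<forall>e\<in>edges C. c e = a)"
proof -
  obtain W' where W': "W' \<subseteq> W" "card W' = n" "finite W'"
    using obtain_subset_with_card_n[OF W(2)] by blast
  have finS: "finite S" using S(1) finite_subset by blast
  obtain h where h: "bij_betw h {..<m} S" "strict_mono_on {..<m} h"
    using ex_bij_betw_strict_mono_card[OF finS] S(2) by auto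
  obtain g where g: "bij_betw g {..<n} W'" "strict_mono_on {..<n} g"
    using ex_bij_betw_strict_mono_card[OF W'(3)] W'(2) by auto
  define u where "u i = h (i - 1)" for i
  define p where "p i = g (i - 1)" for i
  have uS: "u i \<in> S" if "1 \<le> i" "i \<le> m" for i
    using bij_betw_apply[OF h(1), of "i - 1"] that by (auto simp: u_def)
  have pW: "p i \<in> W" if "1 \<le> i" "i \<le> n" for i
    using bij_betw_apply[OF g(1), of "i - 1"] that W'(1) by (auto simp: p_def)
  have u_less: "u i < u j" if "1 \<le> i" "i < j" "j \<le> m" for i j
    unfolding u_def using that by (intro strict_mono_onD[OF h(2)]) auto
  have p_less: "p i < p j" if "1 \<le> i" "i < j" "j \<le> n" for i j
    unfolding p_def using that by (intro strict_mono_onD[OF g(2)]) auto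
  have S_less_W: "x < w" if "x \<in> S" "w \<in> W" for x w
  proof (cases "M \<le> w")
    case False
    then have "x div L < w div L" using pages that by auto
    then show ?thesis using div_le_mono[of w x L] by (meson leD leI)
  qed (use that S(1) in auto)
  have uM: "u i < M" if "1 \<le> i" "i \<le> m" for i using uS[OF that] S(1) by auto
  have pMN: "p i < M + N" if "1 \<le> i" "i \<le> n" for i using pW[OF that] W(1) by auto
  have up: "u i < p j" if "1 \<le> i" "i \<le> m" "1 \<le> j" "j \<le> n" for i j
    using S_less_W uS pW that by blast
  have div_less: "x div L < M" if "x < M" for x
    using that div_le_dividend[of x L] by linarith
  define f where "f v = (case v of Spine i \<Rightarrow> u i | Page i \<Rightarrow> p i)" for v
  have f: "f (Spine i) = u i" "f (Page i) = p i" for i by (simp_all add: f_def)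
  have spine_edge: "{u i, u j} \<in> edges (host L M N)" if "1 \<le> i" "i < j" "j \<le> m" for i j
    unfolding host_simps(2) using u_less[OF that] uM[of i] uM[of j] that
    by (intro CollectI exI[of _ "u i"] exI[of _ "u j"]) auto
  have page_edge: "{u j, p i} \<in> edges (host L M N)" if "1 \<le> i" "i \<le> n" "1 \<le> j" "j \<le> m" for i j
    unfolding host_simps(2) using up[of j i] uM[of j] pMN[of i] that
    by (intro CollectI exI[of _ "u j"] exI[of _ "p i"]) auto
  have edges_book: thesis
    if "e \<in> edges (book m n)"
      "\<And>i j. \<lbrakk>e = {Spine i, Spine j}; 1 \<le> i; i < j; j \<le> m\<rbrakk> \<Longrightarrow> thesis"
      "\<And>i j. \<lbrakk>e = {Page i, Spine j}; 1 \<le> i; i \<le> n; 1 \<le> j; j \<le> m\<rbrakk> \<Longrightarrow> thesis"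
    for e thesis
    using that by (auto simp: book_def)
  have E: "f ` e \<in> edges (host L M N)" if "e \<in> edges (book m n)" for e
    using that by (rule edges_book) (use spine_edge page_edge in \<open>auto simp: f insert_commute\<close>)
  have col: "c (f ` e) = a" if "e \<in> edges (book m n)" for e
    using that
  proof (rule edges_book)
    fix i j assume "e = {Spine i, Spine j}" "1 \<le> i" "i < j" "j \<le> m"
    then show ?thesis
      using spine_col uS[of i] uS[of j] u_less[of i j] by (auto simp: clique_def f)
  next
    fix i j assume "e = {Page i, Spine j}" "1 \<le> i" "i \<le> n" "1 \<le> j" "j \<le> m"
    then show ?thesis
      using page_col uS[of j] pW[of i] by (auto simp: f insert_commute)
  qed
  have spine_key: "edge_key L M {u i, u j} =
      (if u i div L = u j div L then (u i div L, u i div L, u i, u j)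
       else (u i div L, u j div L, u j, u i))" if "1 \<le> i" "i < j" "j \<le> m" for i j
    using u_less[OF that] uM[of j] that by (simp add: edge_key_doubleton)
  have page_key: "edge_key L M {p i, u j} =
      (if M \<le> p i then (M, 0, p i, u j) else (u j div L, p i div L, p i, u j))"
    if "1 \<le> i" "i \<le> n" "1 \<le> j" "j \<le> m" for i j
  proof -
    have "u j div L \<noteq> p i div L" if "\<not> M \<le> p i"
    proof -
      have "u j div L < p i div L" using that pages pW[OF \<open>1 \<le> i\<close> \<open>i \<le> n\<close>] uS[OF \<open>1 \<le> j\<close> \<open>j \<le> m\<close>] by auto
      then show ?thesis by simp
    qed
    then show ?thesis
      using up[of j i] that edge_key_doubleton[of "u j" "p i" L M] by (simp add: insert_commute)
  qed
  have same: "u i div L = u j div L" if "1 \<le> i" "i \<le> m" "1 \<le> j" "j \<le> m"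
      "same_block (\<lambda>x. x div L) S" for i j
    using that uS unfolding same_block_def by blast
  have incr: "u i div L < u j div L"
    if "1 \<le> i" "i < j" "j \<le> m" "inj_on (\<lambda>x. x div L) S" for i j
  proof -
    have "u i div L \<noteq> u j div L"
      using that(4) uS[of i] uS[of j] u_less[of i j] that(1-3) unfolding inj_on_def
      by (metis less_imp_le le_trans nat_less_le)
    moreover have "u i div L \<le> u j div L"
      using u_less[OF that(1-3)] by (intro div_le_mono) simp
    ultimately show ?thesis by simp
  qed
  have less: "edge_key L M (f ` e) < edge_key L M (f ` e')" if less: "(e, e') \<in> eless (book m n)" for e e'
  proof -
    consider
        (ss) i j s t where "e = {Spine i, Spine j}" "e' = {Spine s, Spine t}" "1 \<le> i" "i < j" "j \<le> m"
          "1 \<le> s" "s < t" "t \<le> m" "i < s \<or> i = s \<and> j < t"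
      | (sp) i j s t where "e = {Spine i, Spine j}" "e' = {Page s, Spine t}" "1 \<le> i" "i < j" "j \<le> m"
          "1 \<le> s" "s \<le> n" "1 \<le> t" "t \<le> m"
      | (pp) i j s t where "e = {Page i, Spine j}" "e' = {Page s, Spine t}" "1 \<le> i" "i \<le> n" "1 \<le> j" "j \<le> m"
          "1 \<le> s" "s \<le> n" "1 \<le> t" "t \<le> m" "i < s \<or> i = s \<and> j < t"
      using less by (auto simp: book_def)
    then show ?thesis
    proof cases
      case ss
      have lex: "u i < u s \<or> u i = u s \<and> u j < u t"
        using ss u_less by fastforce
      note keys = spine_key[OF ss(3-5)] spine_key[OF ss(6-8)]
      from blocks have "edge_key L M {u i, u j} < edge_key L M {u s, u t}"
      proof
        assume flat: "same_block (\<lambda>x. x div L) S"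
        then have "u j div L = u i div L" "u s div L = u i div L" "u t div L = u i div L"
          using ss flat same[of j i] same[of s i] same[of t i] by simp_all
        then have "edge_key L M {u i, u j} = (u i div L, u i div L, u i, u j)"
          "edge_key L M {u s, u t} = (u i div L, u i div L, u s, u t)"
          by (simp_all only: keys if_True simp_thms)
        then show ?thesis using lex by (simp only: less_prod_simp) auto
      next
        assume inj: "inj_on (\<lambda>x. x div L) S"
        then have "u i div L < u j div L" "u s div L < u t div L"
          using ss incr by auto
        then have "edge_key L M {u i, u j} = (u i div L, u j div L, u j, u i)"
          "edge_key L M {u s, u t} = (u s div L, u t div L, u t, u s)"
          by (simp_all only: keys if_False less_imp_neq)
        moreover have "u i div L < u s div L \<or> u i = u s \<and> u j div L < u t div L"
          using ss incr[OF _ _ _ inj] by auto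
        ultimately show ?thesis by (simp only: less_prod_simp) auto
      qed
      then show ?thesis by (simp only: ss(1,2) f image_insert image_empty)
    next
      case sp
      note keys = spine_key[OF sp(3-5)] page_key[OF sp(6-9)]
      have "edge_key L M {u i, u j} < edge_key L M {p s, u t}"
      proof (cases "M \<le> p s")
        case True
        have "u i div L < M" using div_less uM[of i] sp by simp
        then show ?thesis using True by (simp add: keys)
      next
        case False
        then have flat: "same_block (\<lambda>x. x div L) S" and lt: "u t div L < p s div L"
          using pages pW[of s] uS[of t] sp by auto
        have "u j div L = u i div L" "u t div L = u i div L"
          using sp same[of j i] same[of t i] flat by simp_all
        then have "edge_key L M {u i, u j} = (u i div L, u i div L, u i, u j)"
          "edge_key L M {p s, u t} = (u i div L, p s div L, p s, u t)" "u i div L < p s div L"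
          using False lt by (simp_all only: keys if_True if_False simp_thms)
        then show ?thesis by (simp only: less_prod_simp) auto
      qed
      then show ?thesis by (simp only: sp(1,2) f image_insert image_empty)
    next
      case pp
      have lex: "p i < p s \<or> p i = p s \<and> u j < u t"
        using pp p_less u_less by fastforce
      note keys = page_key[OF pp(3-6)] page_key[OF pp(7-10)]
      have "edge_key L M {p i, u j} < edge_key L M {p s, u t}"
      proof (cases "M \<le> p s")
        case True
        then have "M \<le> p i" using pages pW[OF pp(3,4)] pW[OF pp(7,8)] by (meson leD)
        then have "edge_key L M {p i, u j} = (M, 0, p i, u j)"
          "edge_key L M {p s, u t} = (M, 0, p s, u t)"
          using True by (simp_all only: keys if_True)
        then show ?thesis using lex by (simp only: less_prod_simp) auto
      next
        case False
        then have flat: "same_block (\<lambda>x. x div L) S" and "\<not> M \<le> p i"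
          using pages pW[of s] pW[of i] pp by auto
        moreover have "u t div L = u j div L"
          using pp flat same[of t j] by simp
        ultimately have "edge_key L M {p i, u j} = (u j div L, p i div L, p i, u j)"
          "edge_key L M {p s, u t} = (u j div L, p s div L, p s, u t)"
          using False by (simp_all only: keys if_False)
        moreover have "p i div L \<le> p s div L"
          using lex by (intro div_le_mono) auto
        ultimately show ?thesis using lex by (simp only: less_prod_simp) auto
      qed
      then show ?thesis by (simp only: pp(1,2) f image_insert image_empty)
    qed
  qed
  have "\<exists>C. eo_copy (book m n) (host L M N) C \<and> edges C = (\<lambda>e. f ` e) ` edges (book m n)"
  proof (rule eo_copy_of_embedding[OF edge_ordered_graph_book edge_ordered_graph_host])
    have "inj_on u {1..m}" "inj_on p {1..n}"
      using u_less p_less by (auto intro!: linorder_inj_onI simp: less_imp_neq)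
    moreover have up': "u i \<noteq> p j" if "i \<in> {1..m}" "j \<in> {1..n}" for i j
      using up[of i j] that by simp
    ultimately have inj: "inj_on u {1..m}" "inj_on p {1..n}"
      "\<And>i j. \<lbrakk>i \<in> {1..m}; j \<in> {1..n}\<rbrakk> \<Longrightarrow> u i \<noteq> p j" by blast+
    have "v = w" if v: "v \<in> verts (book m n)" and w: "w \<in> verts (book m n)" and eq: "f v = f w" for v w
    proof (cases v)
      case vi: (Spine i)
      then have i: "i \<in> {1..m}" using v by (auto simp: book_def)
      show ?thesis
      proof (cases w)
        case (Spine j)
        then have "j \<in> {1..m}" using w by (auto simp: book_def)
        then show ?thesis using inj_onD[OF inj(1) _ i] eq Spine vi by (metis f(1))
      next
        case (Page j)
        then have "j \<in> {1..n}" using w by (auto simp: book_def)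
        then show ?thesis using inj(3)[OF i] eq Page vi by (metis f)
      qed
    next
      case vi: (Page i)
      then have i: "i \<in> {1..n}" using v by (auto simp: book_def)
      show ?thesis
      proof (cases w)
        case (Spine j)
        then have "j \<in> {1..m}" using w by (auto simp: book_def)
        then show ?thesis using inj(3)[OF _ i] eq Spine vi by (metis f)
      next
        case (Page j)
        then have "j \<in> {1..n}" using w by (auto simp: book_def)
        then show ?thesis using inj_onD[OF inj(2) _ i] eq Page vi by (metis f(2))
      qed
    qed
    then show "inj_on f (verts (book m n))" by (rule inj_onI)
    have "f v < M + N" if "v \<in> verts (book m n)" for v
    proof (cases v)
      case (Spine i)
      then show ?thesis using that uM[of i] by (auto simp: book_def f)
    next
      case (Page i)
      then show ?thesis using that pMN[of i] by (auto simp: book_def f)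
    qed
    then show "f ` verts (book m n) \<subseteq> verts (host L M N)"
      by (auto simp: host_simps(1))
    show "(f ` e, f ` e') \<in> eless (host L M N)" if "(e, e') \<in> eless (book m n)" for e e'
    proof -
      have "e \<in> edges (book m n)" "e' \<in> edges (book m n)"
        using that edge_ordered_graph_book by (auto simp: edge_ordered_graph_def)
      then show ?thesis using E less[OF that] by (simp add: host_simps(3))
    qed
  qed (rule E)
  then obtain C where "eo_copy (book m n) (host L M N) C" "edges C = (\<lambda>e. f ` e) ` edges (book m n)"
    by blast
  then show ?thesis using col by (intro exI[of _ C]) auto
qed

section \<open>Cliques whose common neighbourhoods cannot all be small\<close>

text \<open>
  This is the tangent inequality for \<open>(2 - e\<^sup>s)\<^sup>k\<close> at \<open>s = 0\<close>, with \<open>z = 2 - e\<^sup>s\<close>.  The function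
  \<open>z\<^sup>k + k ln (2 - z)\<close> has its minimum over \<open>[0, 3/2]\<close> at \<open>z = 1\<close>, because the sign of its derivative
  is that of \<open>z\<^sup>k\<^sup>-\<^sup>1 (2 - z) - 1\<close>; between \<open>1\<close> and \<open>3/2\<close> this is at least
  \<open>z\<^sup>2 (2 - z) - 1 \<ge> 0\<close>.
\<close>

lemma log_tangent_bound:
  fixes z :: real
  assumes k: "k \<ge> 3" and z: "0 \<le> z" "z \<le> 3/2"
  shows "1 - real k * ln (2 - z) \<le> z ^ k"
proof -
  define g where "g = (\<lambda>z::real. z ^ k + k * ln (2 - z))"
  define g' where "g' = (\<lambda>z::real. k * (z ^ (k - 1) - 1 / (2 - z)))"
  have der: "(g has_real_derivative g' x) (at x)" if "x < 2" for x
    unfolding g_def g'_def using that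
    by (auto intro!: derivative_eq_intros simp: field_simps)
  have "g 1 \<le> g z"
  proof (cases "z \<le> 1")
    case True
    show ?thesis
    proof (rule DERIV_nonpos_imp_nonincreasing[OF True], intro exI conjI)
      fix x assume x: "z \<le> x" "x \<le> 1"
      show "(g has_real_derivative g' x) (at x)" using x der by simp
      have "x ^ (k - 1) \<le> x ^ 1"
        using x z k by (intro power_decreasing) auto
      moreover have "x * (2 - x) \<le> 1"
        using zero_le_power2[of "x - 1"] by (simp add: power2_eq_square algebra_simps)
      then have "x \<le> 1 / (2 - x)"
        using x by (simp add: field_simps)
      ultimately show "g' x \<le> 0"
        by (auto simp: g'_def intro!: mult_nonneg_nonpos)
    qed
  next
    case False
    show ?thesis
    proof (rule DERIV_nonneg_imp_nondecreasing[of 1 z g], use False in simp, intro exI conjI)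
      fix x assume x: "1 \<le> x" "x \<le> z"
      show "(g has_real_derivative g' x) (at x)" using x z der by simp
      have "x ^ 2 \<le> x ^ (k - 1)"
        using x z k by (intro power_increasing) auto
      moreover have "(x - 1) * (x * (x - 1) - 1) \<le> 0"
      proof (rule mult_nonneg_nonpos)
        have "x * (x - 1) \<le> 3/2 * (1/2)" using x z by (intro mult_mono) auto
        then show "x * (x - 1) - 1 \<le> 0" by simp
      qed (use x in simp)
      then have "1 \<le> x ^ 2 * (2 - x)"
        by (simp add: power2_eq_square algebra_simps)
      then have "1 / (2 - x) \<le> x ^ 2"
        using x z by (simp add: field_simps)
      ultimately show "0 \<le> g' x"
        by (auto simp: g'_def)
    qed
  qed
  then show ?thesis by (simp add: g_def)
qed

lemma three_halves_power: "k \<ge> 3 \<Longrightarrow> 9/8 * real k \<le> (3/2) ^ k"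
proof (induction k rule: dec_induct)
  case (step k)
  have "9/8 * real (Suc k) \<le> 3/2 * (9/8 * real k)"
    using step by simp
  also have "\<dots> \<le> 3/2 * (3/2) ^ k"
    using step by simp
  finally show ?case by simp
qed (simp add: power3_eq_cube)

text \<open>
  With \<open>z\<^sub>i = 2 r\<^sub>i\<close> the claim is \<open>(\<Sum>i. z\<^sub>i\<^sup>k) / k + (\<Prod>i. 2 - z\<^sub>i) \<ge> 9/8\<close>.  Let
  \<open>k \<ge> 3\<close>.  If some \<open>z\<^sub>i\<close> exceeds \<open>3/2\<close>, its power suffices.  Otherwise the tangent bound gives \<open>1 - ln w\<close> for the first summand, where
  \<open>w\<close> is the product, and \<open>w - ln w \<ge> 1\<close>.  For \<open>k = 2\<close> the left-hand side is
  \<open>(z\<^sub>0 + z\<^sub>1 - 2)\<^sup>2 / 2 + 2\<close>.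
\<close>

lemma power_mean_plus_prod_complement:
  fixes r :: "nat \<Rightarrow> real"
  assumes k: "k \<ge> 2" and r: "\<And>i. i < k \<Longrightarrow> 0 \<le> r i \<and> r i \<le> 1"
  shows "9/8 \<le> 2 ^ k * ((\<Sum>i<k. r i ^ k) / k + (\<Prod>i<k. 1 - r i))"
proof -
  define z where "z i = 2 * r i" for i
  have z: "0 \<le> z i" "z i \<le> 2" if "i < k" for i
    using r[OF that] by (auto simp: z_def)
  have "9/8 \<le> (\<Sum>i<k. z i ^ k) / k + (\<Prod>i<k. 2 - z i)"
  proof (cases "k = 2")
    case True
    have "0 \<le> (z 0 + z 1 - 2)\<^sup>2" by simp
    then have "4 * z 0 + 4 * z 1 \<le> 4 + (z 0)\<^sup>2 + (z 1)\<^sup>2 + 2 * (z 0 * z 1)"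
      by (simp add: power2_eq_square algebra_simps)
    moreover have P: "(\<Prod>i<k. 2 - z i) = 4 - 2 * z 0 - 2 * z 1 + z 0 * z 1"
      by (simp add: True numeral_2_eq_2 lessThan_Suc algebra_simps)
    moreover have S: "(\<Sum>i<k. z i ^ k) / k = ((z 0)\<^sup>2 + (z 1)\<^sup>2) / 2"
      by (simp add: True numeral_2_eq_2 lessThan_Suc)
    ultimately show ?thesis unfolding P S by argo
  next
    case False
    with k have k3: "k \<ge> 3" by simp
    have P0: "0 \<le> (\<Prod>i<k. 2 - z i)" using z by (intro prod_nonneg) auto
    show ?thesis
    proof (cases "\<exists>j<k. 3/2 < z j")
      case True
      then obtain j where j: "j < k" "3/2 < z j" by blast
      have "9/8 * real k \<le> (3/2) ^ k" by (rule three_halves_power[OF k3])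
      also have "\<dots> \<le> z j ^ k" using j by (intro power_mono) auto
      also have "\<dots> \<le> (\<Sum>i<k. z i ^ k)"
        using j z by (intro member_le_sum) auto
      finally have "9/8 \<le> (\<Sum>i<k. z i ^ k) / k" using k3 by (simp add: field_simps)
      then show ?thesis using P0 by linarith
    next
      case False
      then have small: "z i \<le> 3/2" if "i < k" for i using that by force
      define w where "w = (\<Prod>i<k. 2 - z i)"
      have w: "0 < w" unfolding w_def using small by (intro prod_pos) force
      have "ln w = (\<Sum>i<k. ln (2 - z i))"
        unfolding w_def using small by (intro ln_prod) force+
      then have "real k - k * ln w = (\<Sum>i<k. 1 - k * ln (2 - z i))"
        by (simp add: sum_subtractf sum_distrib_left)
      also have "\<dots> \<le> (\<Sum>i<k. z i ^ k)"
        using k3 z small by (intro sum_mono log_tangent_bound) auto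
      finally have "1 - ln w \<le> (\<Sum>i<k. z i ^ k) / k"
        using k3 by (simp add: field_simps)
      moreover have "ln w \<le> w - 1" by (rule ln_le_minus_one[OF w])
      ultimately show ?thesis unfolding w_def by linarith
    qed
  qed
  also have "(\<Sum>i<k. z i ^ k) / k + (\<Prod>i<k. 2 - z i) =
      2 ^ k * ((\<Sum>i<k. r i ^ k) / k + (\<Prod>i<k. 1 - r i))"
  proof -
    have "(\<Prod>i<k. 2 - z i) = (\<Prod>i<k. 2 * (1 - r i))"
      by (simp add: z_def right_diff_distrib)
    also have "\<dots> = 2 ^ k * (\<Prod>i<k. 1 - r i)"
      by (simp only: prod.distrib prod_constant card_lessThan)
    finally show ?thesis
      by (simp add: z_def power_mult_distrib sum_distrib_left distrib_left)
  qed
  finally show ?thesis .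
qed

lemma double_count:
  assumes "finite A" "finite B"
  shows "(\<Sum>x\<in>A. card {y \<in> B. R x y}) = (\<Sum>y\<in>B. card {x \<in> A. R x y})"
  using sum.swap_restrict[OF assms, of "\<lambda>_ _. 1::nat" R] by simp

text \<open>
  Among the \<open>d\<^sup>k\<close> sequences of length \<open>k\<close> all but at most \<open>k\<^sup>2 t\<^sup>k\<^sup>-\<^sup>1\<close> have distinct entries; multiplication by
  \<open>t\<close> avoids the exponent \<open>k - 1\<close>.
\<close>

lemma power_le_binomial_fact:
  assumes "d \<le> t"
  shows "t * d ^ k \<le> t * ((d choose k) * fact k) + k\<^sup>2 * t ^ k"
proof (induction k)
  case (Suc k)
  have step: "d * ((d choose k) * fact k) \<le> (d choose Suc k) * fact (Suc k) + k * t ^ k"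
  proof -
    have "d * ((d choose k) * fact k) \<le> (d - k) * ((d choose k) * fact k) + k * ((d choose k) * fact k)"
      by (simp flip: distrib_right)
    moreover have "(d - k) * ((d choose k) * fact k) = (d choose Suc k) * fact (Suc k)"
    proof -
      have "(d - k) * (d choose k) = Suc k * (d choose Suc k)"
        by (simp only: binomial_absorb_comp binomial_absorption)
      then have "((d - k) * (d choose k)) * fact k = (Suc k * (d choose Suc k)) * fact k"
        by (rule arg_cong)
      then show ?thesis
        by (simp only: fact_Suc of_nat_id mult_ac)
    qed
    moreover have "(d choose k) * fact k \<le> t ^ k"
      using binomial_fact_pow[of d k] power_mono[OF assms, of k] by simp
    ultimately show ?thesis by (smt (verit) add_le_mono mult_le_mono2 le_trans order_refl)
  qed
  have "t * d ^ Suc k = d * (t * d ^ k)" by simp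
  also have "\<dots> \<le> d * (t * ((d choose k) * fact k) + k\<^sup>2 * t ^ k)"
    using Suc by (intro mult_le_mono2)
  also have "\<dots> = t * (d * ((d choose k) * fact k)) + k\<^sup>2 * (d * t ^ k)"
    by (simp add: algebra_simps)
  also have "\<dots> \<le> t * ((d choose Suc k) * fact (Suc k) + k * t ^ k) + k\<^sup>2 * (t * t ^ k)"
    using step assms by (intro add_mono mult_le_mono) auto
  also have "\<dots> \<le> t * ((d choose Suc k) * fact (Suc k)) + (Suc k)\<^sup>2 * t ^ Suc k"
    by (simp add: power2_eq_square algebra_simps)
  finally show ?case .
qed simp

text \<open>
  Counting the pairs of an \<open>m\<close>-subset of \<open>Q\<close> and a common neighbour of it bounds the sum of the
  binomial coefficients of the degrees; the second summand is the price for replacing them by powers.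
\<close>

lemma binomial_sum_bound:
  assumes V: "finite V" and Q: "finite Q" "card Q = t"
    and few: "\<And>S. S \<subseteq> Q \<Longrightarrow> card S = m \<Longrightarrow> card {v \<in> V. \<forall>x\<in>S. R x v} \<le> n"
  shows "t * (\<Sum>v\<in>V. card {x \<in> Q. R x v} ^ m) \<le> t ^ m * (t * n + m\<^sup>2 * card V)"
proof -
  let ?d = "\<lambda>v. card {x \<in> Q. R x v}"
  let ?F = "{S. S \<subseteq> Q \<and> card S = m}"
  have finF: "finite ?F" using Q(1) by simp
  have "(\<Sum>v\<in>V. ?d v choose m) = (\<Sum>v\<in>V. card {S \<in> ?F. \<forall>x\<in>S. R x v})"
  proof (rule sum.cong[OF refl])
    fix v
    have "{S \<in> ?F. \<forall>x\<in>S. R x v} = {S. S \<subseteq> {x \<in> Q. R x v} \<and> card S = m}" by auto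
    then show "?d v choose m = card {S \<in> ?F. \<forall>x\<in>S. R x v}"
      using Q(1) by (simp add: n_subsets)
  qed
  also have "\<dots> = (\<Sum>S\<in>?F. card {v \<in> V. \<forall>x\<in>S. R x v})"
    by (rule double_count[OF V finF])
  also have "\<dots> \<le> (\<Sum>S\<in>?F. n)" using few by (intro sum_mono) auto
  also have "\<dots> = (t choose m) * n" using Q by (simp add: n_subsets)
  finally have choose: "(\<Sum>v\<in>V. ?d v choose m) \<le> (t choose m) * n" .
  have dt: "?d v \<le> t" for v using Q card_mono[of Q "{x \<in> Q. R x v}"] by auto
  have "t * (\<Sum>v\<in>V. ?d v ^ m) = (\<Sum>v\<in>V. t * ?d v ^ m)" by (rule sum_distrib_left)
  also have "\<dots> \<le> (\<Sum>v\<in>V. t * ((?d v choose m) * fact m) + m\<^sup>2 * t ^ m)"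
    by (intro sum_mono power_le_binomial_fact dt)
  also have "\<dots> = t * (fact m * (\<Sum>v\<in>V. ?d v choose m)) + card V * (m\<^sup>2 * t ^ m)"
    by (simp add: sum.distrib sum_distrib_left mult.commute)
  also have "\<dots> \<le> t * (fact m * ((t choose m) * n)) + card V * (m\<^sup>2 * t ^ m)"
    using choose by (intro add_right_mono mult_le_mono2)
  also have "\<dots> = t * (((t choose m) * fact m) * n) + card V * (m\<^sup>2 * t ^ m)"
    by (simp add: mult_ac)
  also have "\<dots> \<le> t * (t ^ m * n) + card V * (m\<^sup>2 * t ^ m)"
    using binomial_fact_pow[of t m] by (intro add_right_mono mult_le_mono) auto
  also have "\<dots> = t ^ m * (t * n + m\<^sup>2 * card V)" by (simp add: algebra_simps)
  finally show ?thesis .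
qed

text \<open>
  The product counts the transversals of the \<open>Q i\<close> all of whose entries are unrelated to \<open>v\<close>.
\<close>

lemma transversal_sum_bound:
  assumes V: "finite V" and Q: "\<And>i. i < m \<Longrightarrow> finite (Q i) \<and> card (Q i) = t"
    and few: "\<And>f. f \<in> (\<Pi>\<^sub>E i\<in>{..<m}. Q i) \<Longrightarrow> card {v \<in> V. \<forall>i<m. \<not> R (f i) v} \<le> n"
  shows "(\<Sum>v\<in>V. \<Prod>i<m. t - card {x \<in> Q i. R x v}) \<le> t ^ m * n"
proof -
  let ?T = "\<Pi>\<^sub>E i\<in>{..<m}. Q i"
  have Q': "finite (Q i)" "card (Q i) = t" if "i \<in> {..<m}" for i using Q[of i] that by simp_all
  have finT: "finite ?T" using Q'(1) by (rule finite_PiE[OF finite_lessThan])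
  have "(\<Sum>v\<in>V. \<Prod>i<m. t - card {x \<in> Q i. R x v}) = (\<Sum>v\<in>V. card {f \<in> ?T. \<forall>i<m. \<not> R (f i) v})"
  proof (rule sum.cong[OF refl])
    fix v
    have "{f \<in> ?T. \<forall>i<m. \<not> R (f i) v} = (\<Pi>\<^sub>E i\<in>{..<m}. {x \<in> Q i. \<not> R x v})"
    proof (intro set_eqI iffI)
      fix f assume "f \<in> {f \<in> ?T. \<forall>i<m. \<not> R (f i) v}"
      then show "f \<in> (\<Pi>\<^sub>E i\<in>{..<m}. {x \<in> Q i. \<not> R x v})"
        unfolding PiE_iff by blast
    next
      fix f assume "f \<in> (\<Pi>\<^sub>E i\<in>{..<m}. {x \<in> Q i. \<not> R x v})"
      then show "f \<in> {f \<in> ?T. \<forall>i<m. \<not> R (f i) v}"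
        unfolding PiE_iff by blast
    qed
    then have "card {f \<in> ?T. \<forall>i<m. \<not> R (f i) v} = (\<Prod>i<m. card {x \<in> Q i. \<not> R x v})"
      by (simp add: card_PiE)
    also have "\<dots> = (\<Prod>i<m. t - card {x \<in> Q i. R x v})"
    proof (rule prod.cong[OF refl])
      fix i assume "i \<in> {..<m}"
      note Qi = Q'[OF this]
      have "{x \<in> Q i. \<not> R x v} = Q i - {x \<in> Q i. R x v}" by auto
      then show "card {x \<in> Q i. \<not> R x v} = t - card {x \<in> Q i. R x v}"
        using Qi by (simp add: card_Diff_subset)
    qed
    finally show "(\<Prod>i<m. t - card {x \<in> Q i. R x v}) = card {f \<in> ?T. \<forall>i<m. \<not> R (f i) v}" by simp
  qed
  also have "\<dots> = (\<Sum>f\<in>?T. card {v \<in> V. \<forall>i<m. \<not> R (f i) v})"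
    by (rule double_count[OF V finT])
  also have "\<dots> \<le> (\<Sum>f\<in>?T. n)" using few by (rule sum_mono)
  also have "\<dots> = card ?T * n" by simp
  also have "card ?T = (\<Prod>i<m. t)" unfolding card_PiE[OF finite_lessThan] using Q'(2) by (rule prod.cong[OF refl])
  also have "\<dots> * n = t ^ m * n" by simp
  finally show ?thesis .
qed

text \<open>
  Each vertex \<open>v\<close> contributes at least \<open>9/8\<close> times \<open>2\<^sup>-\<^sup>m\<close> to the sum of
  \<open>(\<Sum>i. r\<^sub>i\<^sup>m) / m + (\<Prod>i. 1 - r\<^sub>i)\<close>, where \<open>r\<^sub>i\<close> is the fraction of \<open>Q i\<close> related to \<open>v\<close>, while the two
  counting bounds limit the whole sum to \<open>2 n\<close> plus \<open>m\<^sup>2 |V| / t\<close>.  The condition on \<open>t\<close> makes the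
  last term small enough to be absorbed by the factor \<open>9/8\<close>.
\<close>

lemma card_less_if_few_common_neighbours:
  assumes m: "2 \<le> m" and n: "0 < n" and t: "2 ^ (m + 3) * m\<^sup>2 < t" and V: "finite V"
    and Q: "\<And>i. i < m \<Longrightarrow> finite (Q i) \<and> card (Q i) = t"
    and few1: "\<And>i S. i < m \<Longrightarrow> S \<subseteq> Q i \<Longrightarrow> card S = m \<Longrightarrow> card {v \<in> V. \<forall>x\<in>S. R x v} \<le> n"
    and few2: "\<And>f. f \<in> (\<Pi>\<^sub>E i\<in>{..<m}. Q i) \<Longrightarrow> card {v \<in> V. \<forall>i<m. \<not> R (f i) v} \<le> n"
  shows "card V < 2 ^ (m + 1) * n"
proof (rule ccontr)
  assume V_large: "\<not> ?thesis"
  let ?d = "\<lambda>i v. card {x \<in> Q i. R x v}"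
  have t0: "0 < t" using t by simp
  have 1: "t * (\<Sum>v\<in>V. ?d i v ^ m) \<le> t ^ m * (t * n + m\<^sup>2 * card V)" if "i < m" for i
    by (rule binomial_sum_bound[OF V _ _ few1[OF that]]) (use Q[OF that] in simp_all)
  have 2: "(\<Sum>v\<in>V. \<Prod>i<m. t - ?d i v) \<le> t ^ m * n"
    by (rule transversal_sum_bound[OF V Q few2])
  have dt: "?d i v \<le> t" if "i < m" for i v
    using Q[OF that] card_mono[of "Q i" "{x \<in> Q i. R x v}"] by auto
  define r where "r i v = real (?d i v) / t" for i v
  have r: "0 \<le> r i v \<and> r i v \<le> 1" if "i < m" for i v
    using dt[OF that] t0 by (simp add: r_def)
  define err where "err = m\<^sup>2 * card V / real t"
  have 1: "(\<Sum>v\<in>V. r i v ^ m) \<le> n + err" if "i < m" for i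
  proof -
    define X where "X = (\<Sum>v\<in>V. real (?d i v) ^ m)"
    have "real (t * (\<Sum>v\<in>V. ?d i v ^ m)) \<le> real (t ^ m * (t * n + m\<^sup>2 * card V))"
      using 1[OF that] by (rule of_nat_mono)
    then have "real t * X \<le> real t ^ m * (real t * n + m\<^sup>2 * card V)"
      unfolding X_def by simp
    then have "X \<le> real t ^ m * (real t * n + m\<^sup>2 * card V) / t"
      using t0 by (simp only: pos_le_divide_eq of_nat_0_less_iff mult.commute)
    also have "\<dots> = (n + err) * real t ^ m"
      using t0 by (simp add: err_def distrib_left distrib_right add_divide_distrib)
    finally have "X / real t ^ m \<le> n + err"
      using t0 by (simp only: pos_divide_le_eq of_nat_0_less_iff zero_less_power)
    moreover have "(\<Sum>v\<in>V. r i v ^ m) = X / real t ^ m"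
      unfolding X_def r_def power_divide by (rule sum_divide_distrib[symmetric])
    ultimately show ?thesis by simp
  qed
  have 2: "(\<Sum>v\<in>V. \<Prod>i<m. 1 - r i v) \<le> n"
  proof -
    have P: "(\<Prod>i<m. 1 - r i v) = (\<Prod>i<m. real (t - ?d i v)) / real t ^ m" for v
    proof -
      have "(\<Prod>i<m. 1 - r i v) = (\<Prod>i<m. real (t - ?d i v) / t)"
        using dt t0 by (intro prod.cong refl) (simp add: r_def of_nat_diff diff_divide_distrib)
      then show ?thesis by (simp add: prod_dividef)
    qed
    have "(\<Sum>v\<in>V. \<Prod>i<m. 1 - r i v) = (\<Sum>v\<in>V. \<Prod>i<m. real (t - ?d i v)) / real t ^ m"
      unfolding P by (rule sum_divide_distrib[symmetric])
    also have "(\<Sum>v\<in>V. \<Prod>i<m. real (t - ?d i v)) = real (\<Sum>v\<in>V. \<Prod>i<m. t - ?d i v)"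
      by (simp only: of_nat_sum of_nat_prod)
    also have "\<dots> / real t ^ m \<le> real (t ^ m * n) / real t ^ m"
      using 2 by (intro divide_right_mono of_nat_mono) simp_all
    also have "\<dots> = n" using t0 by simp
    finally show ?thesis .
  qed
  have "9/8 * real (card V) = (\<Sum>v\<in>V. 9/8)" by simp
  also have "\<dots> \<le> (\<Sum>v\<in>V. 2 ^ m * ((\<Sum>i<m. r i v ^ m) / m + (\<Prod>i<m. 1 - r i v)))"
    using r by (intro sum_mono power_mean_plus_prod_complement m) auto
  also have "\<dots> = 2 ^ m * ((\<Sum>i<m. \<Sum>v\<in>V. r i v ^ m) / m + (\<Sum>v\<in>V. \<Prod>i<m. 1 - r i v))"
  proof -
    have "(\<Sum>v\<in>V. 2 ^ m * ((\<Sum>i<m. r i v ^ m) / m + (\<Prod>i<m. 1 - r i v))) =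
        2 ^ m * ((\<Sum>v\<in>V. \<Sum>i<m. r i v ^ m) / m + (\<Sum>v\<in>V. \<Prod>i<m. 1 - r i v))"
      unfolding sum_divide_distrib[of _ V] sum.distrib[symmetric] by (rule sum_distrib_left[symmetric])
    also have "(\<Sum>v\<in>V. \<Sum>i<m. r i v ^ m) = (\<Sum>i<m. \<Sum>v\<in>V. r i v ^ m)" by (rule sum.swap)
    finally show ?thesis .
  qed
  also have "\<dots> \<le> 2 ^ m * ((\<Sum>i<m. n + err) / m + n)"
    using 1 2 by (intro mult_left_mono add_mono divide_right_mono sum_mono) auto
  also have "\<dots> = 2 ^ m * (2 * n + err)"
    using m by simp
  finally have upper: "9/8 * real (card V) \<le> 2 ^ (m + 1) * n + 2 ^ m * err"
    by (simp add: distrib_left)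
  have "0 < 2 ^ (m + 1) * n" using n by simp
  then have V0: "0 < real (card V)" using V_large by linarith
  have "8 * (2 ^ m * m\<^sup>2) < t" using t by (simp add: power_add)
  then have "real (8 * (2 ^ m * m\<^sup>2)) < t"
    by (rule of_nat_less_iff[THEN iffD2])
  then have "8 * (2 ^ m * real (m\<^sup>2)) < t"
    by simp
  then have "8 * (2 ^ m * real (m\<^sup>2)) * card V < t * real (card V)"
    using V0 by (rule mult_strict_right_mono)
  then have "8 * (2 ^ m * err) < card V"
    using t0 by (simp add: err_def pos_divide_less_eq mult.commute mult.left_commute)
  moreover have "real (2 ^ (m + 1) * n) \<le> card V"
    using V_large by (intro of_nat_mono) simp
  ultimately show False using upper by linarith
qed

section \<open>Half of the spine is rich in cliques of one colour\<close>

text \<open>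
  The finite disjoint unions of members of \<open>F\<close>.
\<close>

inductive tiled :: "'a set set \<Rightarrow> 'a set \<Rightarrow> bool" for F :: "'a set set" where
  tiled_empty: "tiled F {}"
| tiled_insert: "tiled F A \<Longrightarrow> T \<in> F \<Longrightarrow> T \<inter> A = {} \<Longrightarrow> tiled F (A \<union> T)"

text \<open>
  Averaging over the tiles: a set that meets each of them in at most \<open>k\<close> points has density at most
  \<open>k / s\<close> in their union.
\<close>

lemma tiled_meets_tile:
  assumes "tiled F A" "\<And>T. T \<in> F \<Longrightarrow> finite T \<and> card T = s" "\<And>T. T \<in> F \<Longrightarrow> card (T \<inter> Y) \<le> k"
  shows "finite A \<and> s * card (A \<inter> Y) \<le> k * card A"
  using assms
proof (induction rule: tiled.induct)
  case (tiled_insert A T)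
  then have fin: "finite A" "finite T" and T: "card T = s" "card (T \<inter> Y) \<le> k"
    and IH: "s * card (A \<inter> Y) \<le> k * card A" by auto
  have "(A \<union> T) \<inter> Y = (A \<inter> Y) \<union> (T \<inter> Y)" by blast
  then have "card ((A \<union> T) \<inter> Y) = card (A \<inter> Y) + card (T \<inter> Y)"
    using fin tiled_insert.hyps(3) by (simp only:) (rule card_Un_disjoint; blast)
  moreover have "card (A \<union> T) = card A + s"
    using fin T tiled_insert.hyps(3) by (simp add: card_Un_disjoint Int_commute)
  ultimately have "s * card ((A \<union> T) \<inter> Y) \<le> k * card (A \<union> T)"
    using add_mono[OF IH mult_le_mono2[OF T(2), of s]] by (simp only: distrib_left mult.commute[of k s])
  then show ?case using fin by simp
qed simp

text \<open>
  Take a maximal disjoint union of large red cliques, each inside one block.  A dense subset of this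
  union has a large intersection with one of the cliques.  Outside the union there is no further
  large red clique in a block, so a dense subset of the complement meets some block in many vertices
  and there contains a blue clique by Ramsey's theorem.  One of the two sets has at least \<open>M / 2\<close>
  elements.
\<close>

lemma ex_clique_rich_half:
  assumes "0 < p" "0 < K"
  shows "\<exists>q0. \<forall>q\<ge>q0. \<forall>M (b :: nat \<Rightarrow> nat) (c :: nat set \<Rightarrow> colour).
    M \<le> p * q \<longrightarrow> (\<forall>x<M. b x < h) \<longrightarrow>
    (\<exists>a A. A \<subseteq> {..<M} \<and> M \<le> 2 * card A \<and>
       (\<forall>Y\<subseteq>A. q \<le> 2 * card Y \<longrightarrow>
          (\<exists>Q\<subseteq>Y. card Q = K \<and> clique Q {e. c e = a} \<and> same_block b Q)))"
proof -
  define s where "s = 2 * p * K"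
  have s: "0 < s" "K \<le> s" using assms by (simp_all add: s_def)
  obtain R where R: "\<And>(V :: nat set) E. finite V \<Longrightarrow> R \<le> card V \<Longrightarrow>
      \<exists>U\<subseteq>V. card U = s \<and> clique U E \<or> card U = K \<and> indep U E"
    using ramsey2[of s K] by blast
  show ?thesis
  proof (intro exI[of _ "2 * h * R + 1"] allI impI)
    fix q M and b :: "nat \<Rightarrow> nat" and c :: "nat set \<Rightarrow> colour"
    assume q: "2 * h * R + 1 \<le> q" and M: "M \<le> p * q" and b: "\<forall>x<M. b x < h"
    define good where "good a k Q \<longleftrightarrow> Q \<subseteq> {..<M} \<and> card Q = k \<and> clique Q {e. c e = a} \<and>
        same_block b Q" for a k Q
    have good_sub: "\<exists>Q'\<subseteq>Q. good a K Q'" if "good a k P" "Q \<subseteq> P" "K \<le> card Q" for a k P Q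
    proof -
      obtain Q' where "Q' \<subseteq> Q" "card Q' = K" using obtain_subset_with_card_n[OF \<open>K \<le> card Q\<close>] by blast
      then show ?thesis
        using that unfolding good_def
        by (intro exI[of _ Q']) (meson order_trans smaller_clique same_block_subset)
    qed
    (* The factor 2 p in s is the reciprocal of the smallest density of Y that has to be dealt with,
       since card A <= M <= p * q <= 2 * p * card Y. *)
    define F where "F = {Q. good Red s Q}"
    have F: "finite T \<and> card T = s" "T \<subseteq> {..<M}" if "T \<in> F" for T
      using that finite_subset[of T "{..<M}"] by (auto simp: F_def good_def)
    have tiled_sub: "A \<subseteq> {..<M}" if "tiled F A" for A
      using that by induction (use F in auto)
    obtain A where A: "tiled F A" and maxA: "\<And>A'. tiled F A' \<Longrightarrow> card A' \<le> card A"
    proof -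
      have "card A' < Suc M" if "tiled F A'" for A'
        using card_mono[OF _ tiled_sub[OF that]] by simp
      then show ?thesis
        using ex_has_greatest_nat[of "tiled F" "{}" card "Suc M"] tiled_empty[of F] that by blast
    qed
    note AM = tiled_sub[OF A]
    have Qrich: "\<exists>Q\<subseteq>Y. good Red K Q" if Y: "Y \<subseteq> A" "q \<le> 2 * card Y" for Y
    proof (rule ccontr)
      assume none: "\<not> ?thesis"
      have "card (T \<inter> Y) \<le> K - 1" if "T \<in> F" for T
        using none good_sub[of Red s T "T \<inter> Y"] that by (force simp: F_def)
      then have "s * card (A \<inter> Y) \<le> (K - 1) * card A"
        using tiled_meets_tile[OF A] F by blast
      also have "\<dots> \<le> (K - 1) * (p * (2 * card Y))"
      proof -
        have "card A \<le> M" using card_mono[OF _ AM] by simp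
        also note M
        also have "p * q \<le> p * (2 * card Y)" using Y by simp
        finally show ?thesis by simp
      qed
      finally have "(2 * p * card Y) * K \<le> (2 * p * card Y) * (K - 1)"
        using Y by (simp add: Int_absorb1 s_def mult_ac)
      then show False using assms Y q by auto
    qed
    have Brich: "\<exists>Q\<subseteq>Y. good Blue K Q" if Y: "Y \<subseteq> {..<M} - A" "q \<le> 2 * card Y" for Y
    proof -
      have finY: "finite Y" using Y finite_subset by blast
      have "\<exists>\<beta><h. R \<le> card {x \<in> Y. b x = \<beta>}"
      proof (rule ccontr)
        assume "\<not> ?thesis"
        then have small: "card {x \<in> Y. b x = \<beta>} \<le> R" if "\<beta> < h" for \<beta> using that by force
        have "Y = (\<Union>\<beta><h. {x \<in> Y. b x = \<beta>})" using Y b by auto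
        then have "card Y \<le> (\<Sum>\<beta><h. card {x \<in> Y. b x = \<beta>})"
          by (metis card_UN_le finite_lessThan)
        also have "\<dots> \<le> h * R" using sum_mono[of "{..<h}", OF small] by simp
        finally show False using q Y by simp
      qed
      then obtain \<beta> where "R \<le> card {x \<in> Y. b x = \<beta>}" by blast
      then obtain U where U: "U \<subseteq> {x \<in> Y. b x = \<beta>}"
        "card U = s \<and> clique U {e. c e = Red} \<or> card U = K \<and> indep U {e. c e = Red}"
        using R[of "{x \<in> Y. b x = \<beta>}"] finY by auto
      have "\<not> (card U = s \<and> clique U {e. c e = Red})"
      proof
        assume r: "card U = s \<and> clique U {e. c e = Red}"
        then have "U \<in> F" using U(1) Y(1) by (auto simp: F_def good_def same_block_def)
        moreover have disj: "U \<inter> A = {}" using U(1) Y(1) by blast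
        ultimately have "card (A \<union> U) \<le> card A" using A tiled_insert maxA by blast
        moreover have "finite A" using AM finite_subset by blast
        ultimately show False
          using r s disj F[OF \<open>U \<in> F\<close>] by (simp add: card_Un_disjoint Int_commute)
      qed
      then have "card U = K" "indep U {e. c e = Red}" using U(2) by auto
      moreover have "same_block b U"
      proof -
        have "b x = \<beta>" if "x \<in> U" for x using U(1) that by auto
        then show ?thesis by (simp add: same_block_def)
      qed
      moreover have "c e = Blue" if "c e \<noteq> Red" for e using that by (cases "c e") simp_all
      ultimately have "good Blue K U"
        using U(1) Y(1) by (auto simp: good_def clique_def indep_def)
      then show ?thesis using U(1) by blast
    qed
    show "\<exists>a A. A \<subseteq> {..<M} \<and> M \<le> 2 * card A \<and>
       (\<forall>Y\<subseteq>A. q \<le> 2 * card Y \<longrightarrow>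
          (\<exists>Q\<subseteq>Y. card Q = K \<and> clique Q {e. c e = a} \<and> same_block b Q))"
    proof (cases "M \<le> 2 * card A")
      case True
      then show ?thesis
        using AM Qrich unfolding good_def by (intro exI[of _ Red] exI[of _ A]) blast
    next
      case False
      have "card ({..<M} - A) = M - card A"
        using AM by (simp add: card_Diff_subset finite_subset)
      then show ?thesis
        using False Brich unfolding good_def
        by (intro exI[of _ Blue] exI[of _ "{..<M} - A"]) auto
    qed
  qed
qed

section \<open>A chain of cliques joined by the opposite colour\<close>

definition common_nbrs :: "('a set \<Rightarrow> 'b) \<Rightarrow> 'b \<Rightarrow> 'a set \<Rightarrow> 'a set \<Rightarrow> 'a set" where
  "common_nbrs c a Y S = {v \<in> Y. \<forall>x\<in>S. c {x, v} = a}"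

text \<open>
  Cut \<open>Q\<close> into \<open>2 s\<close> parts of size \<open>\<tau>\<close>.  A vertex with fewer than \<open>s\<close> edges to \<open>Q\<close> in other colours
  than \<open>a\<close> is a common \<open>a\<close>-neighbour of at least \<open>s\<close> of the parts, and each part has at most \<open>n / D\<close>
  common \<open>a\<close>-neighbours.
\<close>

lemma few_vertices_with_few_nonneighbours:
  assumes Q: "finite Q" "card Q = 2 * \<tau> * s" and s: "0 < s" and Y: "finite Y"
    and few: "\<And>P. P \<subseteq> Q \<Longrightarrow> \<tau> \<le> card P \<Longrightarrow> D * card (common_nbrs c a Y P) \<le> n"
  shows "D * card {v \<in> Y. card {x \<in> Q. c {x, v} \<noteq> a} < s} \<le> 2 * n"
proof -
  let ?X = "{v \<in> Y. card {x \<in> Q. c {x, v} \<noteq> a} < s}"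
  obtain h where h: "bij_betw h {..<2 * \<tau> * s} Q"
    using ex_bij_betw_nat_finite[OF Q(1)] Q(2) by (auto simp: atLeast0LessThan)
  define P where "P i = h ` {i * \<tau>..<Suc i * \<tau>}" for i
  have range: "{i * \<tau>..<Suc i * \<tau>} \<subseteq> {..<2 * \<tau> * s}" if "i < 2 * s" for i
  proof -
    have "Suc i * \<tau> \<le> 2 * s * \<tau>" using that by (intro mult_le_mono1) simp
    then show ?thesis by (auto simp: mult_ac)
  qed
  have hinj: "inj_on h {..<2 * \<tau> * s}" using h by (simp add: bij_betw_def)
  have PQ: "P i \<subseteq> Q" and cardP: "card (P i) = \<tau>" if "i < 2 * s" for i
  proof -
    show "P i \<subseteq> Q" using range[OF that] h by (auto simp: P_def bij_betw_def)
    show "card (P i) = \<tau>"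
      unfolding P_def using card_image[OF inj_on_subset[OF hinj range[OF that]]] by simp
  qed
  have disj: "i = j" if "i < 2 * s" "j < 2 * s" "x \<in> P i" "x \<in> P j" for i j x
  proof -
    from that(3) obtain k where k: "x = h k" "k \<in> {i * \<tau>..<Suc i * \<tau>}"
      unfolding P_def by blast
    from that(4) obtain l where l: "x = h l" "l \<in> {j * \<tau>..<Suc j * \<tau>}"
      unfolding P_def by blast
    have "k = l"
      using inj_onD[OF hinj, of k l] k l range[OF that(1)] range[OF that(2)] by blast
    then have "k div \<tau> = i" "k div \<tau> = j"
      using k l by (auto intro!: div_nat_eqI simp: mult.commute)
    then show ?thesis by simp
  qed
  (* Each part of which v is not a common a-neighbour has a vertex joined to v in another colour,
     and the parts are disjoint. *)
  have many: "s \<le> card {i \<in> {..<2 * s}. v \<in> common_nbrs c a Y (P i)}" if v: "v \<in> ?X" for v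
  proof -
    let ?I = "{i \<in> {..<2 * s}. v \<notin> common_nbrs c a Y (P i)}"
    have "\<exists>x. x \<in> P i \<and> c {x, v} \<noteq> a" if "i \<in> ?I" for i
      using that v by (auto simp: common_nbrs_def)
    then obtain w where w: "\<And>i. i \<in> ?I \<Longrightarrow> w i \<in> P i \<and> c {w i, v} \<noteq> a" by metis
    have "inj_on w ?I" using w disj by (intro inj_onI) (metis (no_types, lifting) lessThan_iff mem_Collect_eq)
    moreover have "w ` ?I \<subseteq> {x \<in> Q. c {x, v} \<noteq> a}" using w PQ by fastforce
    ultimately have "card ?I \<le> card {x \<in> Q. c {x, v} \<noteq> a}"
      using Q(1) by (intro card_inj_on_le) auto
    then have "card ?I < s" using v by simp
    moreover have "card {..<2 * s} = card ({i \<in> {..<2 * s}. v \<in> common_nbrs c a Y (P i)} \<union> ?I)"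
      by (rule arg_cong[of _ _ card]) auto
    then have "2 * s = card {i \<in> {..<2 * s}. v \<in> common_nbrs c a Y (P i)} + card ?I"
      by (subst (asm) card_Un_disjoint) auto
    ultimately show ?thesis by linarith
  qed
  have "s * card ?X \<le> (\<Sum>v\<in>?X. card {i \<in> {..<2 * s}. v \<in> common_nbrs c a Y (P i)})"
    using sum_mono[of ?X "\<lambda>_. s", OF many] by (simp add: mult.commute)
  also have "\<dots> = (\<Sum>i<2 * s. card {v \<in> ?X. v \<in> common_nbrs c a Y (P i)})"
    using Y by (intro double_count) auto
  also have "\<dots> \<le> (\<Sum>i<2 * s. card (common_nbrs c a Y (P i)))"
    using Y by (intro sum_mono card_mono) (auto simp: common_nbrs_def)
  finally have "D * (s * card ?X) \<le> (\<Sum>i<2 * s. D * card (common_nbrs c a Y (P i)))"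
    by (simp add: sum_distrib_left[symmetric])
  also have "\<dots> \<le> (\<Sum>i<2 * s. n)"
    using few PQ cardP by (intro sum_mono) simp
  finally have "s * (D * card ?X) \<le> s * (2 * n)" by (simp add: mult_ac)
  then show ?thesis using s by simp
qed

text \<open>
  As long as the current set \<open>P\<close> has a subset that is large at the next lower scale and on which \<open>f\<close>
  is larger by more than \<open>n / D\<close>, pass to it.  Since \<open>f\<close> is bounded by \<open>n\<close>, this stops within \<open>D\<close>
  steps.  It is applied to the number of common neighbours, which grows when \<open>P\<close> shrinks: for a
  stable \<open>P\<close>, passing to a large subset creates few new common neighbours.
\<close>

lemma ex_stable_subset:
  fixes f :: "'a set \<Rightarrow> nat" and T :: "nat \<Rightarrow> nat"
  assumes D: "0 < D" and T: "mono T" and Q: "T D \<le> card Q"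
    and bound: "\<And>P. P \<subseteq> Q \<Longrightarrow> T 0 \<le> card P \<Longrightarrow> f P < n"
  shows "\<exists>i<D. \<exists>P\<subseteq>Q. T (Suc i) \<le> card P \<and>
           (\<forall>P'\<subseteq>P. T i \<le> card P' \<longrightarrow> D * f P' \<le> D * f P + n)"
proof -
  have "\<exists>i<D. \<exists>P\<subseteq>Q. T (Suc i) \<le> card P \<and>
           (\<forall>P'\<subseteq>P. T i \<le> card P' \<longrightarrow> D * f P' \<le> D * f P + n)"
    if "R \<subseteq> Q" "r \<le> D" "T r \<le> card R" "D * n \<le> D * f R + r * n" for R r
    using that
  proof (induction r arbitrary: R)
    case 0
    then have "D * f R < D * n" using bound[of R] D by simp
    then show ?case using 0 by simp
  next
    case (Suc r)
    show ?case
    proof (cases "\<forall>P'\<subseteq>R. T r \<le> card P' \<longrightarrow> D * f P' \<le> D * f R + n")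
      case True
      then show ?thesis using Suc.prems by (metis Suc_le_eq)
    next
      case False
      then obtain P' where P': "P' \<subseteq> R" "T r \<le> card P'" "D * f R + n < D * f P'"
        by (auto simp: not_le)
      then have "D * n \<le> D * f P' + r * n" using Suc.prems(4) by simp
      then show ?thesis using Suc.IH[of P'] P' Suc.prems by simp
    qed
  qed
  from this[OF order_refl order_refl Q] show ?thesis by simp
qed

text \<open>
  A set of size \<open>threshold m t (Suc i)\<close> may lose all but a fraction of \<open>1 / (2 \<tau>)\<close> of its elements \<open>m\<close>
  times in a row and still has \<open>\<tau> = threshold m t i\<close> elements.
\<close>

primrec threshold :: "nat \<Rightarrow> nat \<Rightarrow> nat \<Rightarrow> nat" where
  "threshold m t 0 = t"
| "threshold m t (Suc i) = (2 * threshold m t i) ^ m * threshold m t i"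

lemma threshold_pos: "0 < t \<Longrightarrow> 0 < threshold m t i"
  by (induction i) auto

lemma mono_threshold:
  assumes "0 < t"
  shows "mono (threshold m t)"
proof (rule incseq_SucI)
  fix i
  have "1 \<le> (2 * threshold m t i) ^ m"
    using threshold_pos[OF assms, of m i] by (simp add: Suc_le_eq)
  then show "threshold m t i \<le> threshold m t (Suc i)"
    by simp
qed

text \<open>
  The cliques are chosen one after the other, and those already chosen shrink whenever a new one is
  added.  The delicate point is that each clique may disqualify only about \<open>n\<close> vertices altogether,
  although it is shrunk up to \<open>m\<close> times.  Therefore each new clique is made stable before its common
  \<open>a\<close>-neighbours, fewer than \<open>n\<close> of them, are removed from the set \<open>Y\<close> of vertices that are still
  available.  Then every large subset of it has at most \<open>n / D\<close> common \<open>a\<close>-neighbours in \<open>Y\<close>, however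
  it is shrunk later.

  Only later blocks are available for the following cliques.  A new clique is found among the first
  \<open>q\<close> to \<open>2 q\<close> elements of \<open>Y\<close>, in the order of the blocks, so this costs at most \<open>2 q\<close> vertices per step.  The
  steps before the last one consume at most \<open>(m - 1) (n + 2 q) \<le> m n - 2 q\<close> vertices.
\<close>

lemma clique_chain:
  fixes c :: "nat set \<Rightarrow> 'c" and b :: "nat \<Rightarrow> nat"
  assumes A: "finite A" "m * n \<le> card A"
    and block: "\<And>\<beta>. card {x \<in> A. b x = \<beta>} \<le> q"
    and q: "0 < q" "2 * m * q \<le> n" "4 * m * n \<le> D * q"
    and t: "m \<le> t" and m: "0 < m"
    and book: "\<And>S. S \<subseteq> A \<Longrightarrow> card S = m \<Longrightarrow> same_block b S \<Longrightarrow> clique S {e. c e = a} \<Longrightarrow>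
      card (common_nbrs c a {v \<in> A. \<forall>x\<in>S. b x < b v} S) < n"
    and rich: "\<And>Y. Y \<subseteq> A \<Longrightarrow> q \<le> 2 * card Y \<Longrightarrow>
      \<exists>Q\<subseteq>Y. card Q = threshold m t D * 2 ^ (m * threshold m t D) \<and>
        clique Q {e. c e = a} \<and> same_block b Q"
  obtains Q where
    "\<And>i. i < m \<Longrightarrow> Q i \<subseteq> A \<and> card (Q i) = t \<and> clique (Q i) {e. c e = a} \<and> same_block b (Q i)"
    "\<And>i j x y. i < j \<Longrightarrow> j < m \<Longrightarrow> x \<in> Q i \<Longrightarrow> y \<in> Q j \<Longrightarrow> b x < b y \<and> c {x, y} \<noteq> a"
proof -
  define T where "T = threshold m t"
  have t0: "0 < t" using t m by simp
  have T: "mono T" "T 0 = t" "T (Suc i) = (2 * T i) ^ m * T i" "0 < T i" for i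
    using mono_threshold[OF t0] threshold_pos[OF t0] by (simp_all add: T_def)
  have D0: "0 < D" using q m by (cases D) auto
  have size_le: "(2 * T i) ^ (m - j) * T i \<le> T (Suc i)" for i j
  proof -
    have "(2 * T i) ^ (m - j) \<le> (2 * T i) ^ m"
      using T(4)[of i] by (intro power_increasing) auto
    then show ?thesis unfolding T(3) by (rule mult_le_mono1)
  qed
  (* Q i for i < j are the cliques chosen so far, l i is the scale at which Q i is stable, and Y
     is the set of vertices still available.  The size of Q i allows for m - j further losses. *)
  define inv where "inv j Q l Y \<longleftrightarrow> Y \<subseteq> A \<and> m * n \<le> card Y + j * (n + 2 * q) \<and>
     (\<forall>i<j. Q i \<subseteq> A \<and> clique (Q i) {e. c e = a} \<and> same_block b (Q i) \<and>
        (\<forall>x\<in>Q i. \<forall>y\<in>Y. b x < b y) \<and> l i < D \<and>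
        card (Q i) = (2 * T (l i)) ^ (m - j) * T (l i) \<and>
        (\<forall>P\<subseteq>Q i. T (l i) \<le> card P \<longrightarrow> D * card (common_nbrs c a Y P) \<le> n)) \<and>
     (\<forall>i' i. i < i' \<longrightarrow> i' < j \<longrightarrow> (\<forall>x\<in>Q i. \<forall>y\<in>Q i'. b x < b y \<and> c {x, y} \<noteq> a))" for j Q l Y
  have "\<exists>Q l Y. inv j Q l Y" if "j \<le> m" for j
    using that
  proof (induction j)
    case 0
    show ?case unfolding inv_def using A by (intro exI[of _ "\<lambda>_. {}"] exI[of _ "\<lambda>_. 0"] exI[of _ A]) simp
  next
    case (Suc j)
    then obtain Q l Y where inv: "inv j Q l Y" by (meson Suc_leD)
    note parts = inv[unfolded inv_def]
    note Y = parts[THEN conjunct1] parts[THEN conjunct2, THEN conjunct1]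
    have QQ: "b x < b y \<and> c {x, y} \<noteq> a" if "i < i'" "i' < j" "x \<in> Q i" "y \<in> Q i'" for i i' x y
      using parts[THEN conjunct2, THEN conjunct2, THEN conjunct2] that by metis
    have inv_i: "Q i \<subseteq> A \<and> clique (Q i) {e. c e = a} \<and> same_block b (Q i) \<and>
        (\<forall>x\<in>Q i. \<forall>y\<in>Y. b x < b y) \<and> l i < D \<and>
        card (Q i) = (2 * T (l i)) ^ (m - j) * T (l i) \<and>
        (\<forall>P\<subseteq>Q i. T (l i) \<le> card P \<longrightarrow> D * card (common_nbrs c a Y P) \<le> n)" if "i < j" for i
      using parts[THEN conjunct2, THEN conjunct2, THEN conjunct1, THEN spec, THEN mp, OF that] .
    have Q: "Q i \<subseteq> A \<and> clique (Q i) {e. c e = a} \<and> same_block b (Q i)" if "i < j" for i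
      using inv_i[OF that] by (elim conjE) (intro conjI; assumption)
    have QY: "b x < b y" if "i < j" "x \<in> Q i" "y \<in> Y" for i x y
      using inv_i[OF that(1)] that by (elim conjE) blast
    have l: "l i < D" if "i < j" for i
      using inv_i[OF that] by (elim conjE) assumption
    have cardQ: "card (Q i) = (2 * T (l i)) ^ (m - j) * T (l i)" if "i < j" for i
      using inv_i[OF that] by (elim conjE) assumption
    have stable: "D * card (common_nbrs c a Y P) \<le> n" if "i < j" "P \<subseteq> Q i" "T (l i) \<le> card P" for i P
      using inv_i[OF that(1)] that(2,3) by (elim conjE) blast
    have finY: "finite Y" using Y(1) A(1) finite_subset by blast
    have finQ: "finite (Q i)" if "i < j" for i using Q[OF that] A(1) finite_subset by blast
    have jm: "j < m" using Suc.prems by simp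
    have "q \<le> card Y"
    proof -
      have "Suc j * n \<le> m * n" "2 * (Suc j * q) \<le> 2 * (m * q)"
        using jm by (intro mult_le_mono; simp)+
      then show ?thesis using Y(2) q by (simp add: algebra_simps)
    qed
    have ex\<beta>: "\<exists>\<beta>. q \<le> card {v \<in> Y. b v \<le> \<beta>}"
    proof
      have "{v \<in> Y. b v \<le> Max (b ` Y)} = Y" using finY by auto
      then show "q \<le> card {v \<in> Y. b v \<le> Max (b ` Y)}" using \<open>q \<le> card Y\<close> by simp
    qed
    (* P is the shortest initial segment of Y, in units of blocks, that has at least q elements. *)
    define \<beta> where "\<beta> = (LEAST \<beta>. q \<le> card {v \<in> Y. b v \<le> \<beta>})"
    define P where "P = {v \<in> Y. b v \<le> \<beta>}"
    define Z where "Z = {v \<in> Y. \<beta> < b v}"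
    have P: "P \<subseteq> Y" "q \<le> card P" using LeastI_ex[OF ex\<beta>] by (auto simp: P_def \<beta>_def)
    have "card P \<le> 2 * q"
    proof -
      have "card {v \<in> Y. b v < \<beta>} \<le> q"
      proof (cases \<beta>)
        case (Suc \<beta>')
        then have "card {v \<in> Y. b v \<le> \<beta>'} < q"
          using not_less_Least[of \<beta>' "\<lambda>\<beta>. q \<le> card {v \<in> Y. b v \<le> \<beta>}"] by (simp add: \<beta>_def)
        then show ?thesis by (simp add: Suc less_Suc_eq_le)
      qed simp
      moreover have "P \<subseteq> {v \<in> Y. b v < \<beta>} \<union> {x \<in> A. b x = \<beta>}"
        using Y(1) by (auto simp: P_def)
      then have "card P \<le> card {v \<in> Y. b v < \<beta>} + card {x \<in> A. b x = \<beta>}"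
        by (intro order_trans[OF card_mono card_Un_le]) (use finY A(1) in auto)
      ultimately show ?thesis using block[of \<beta>] by simp
    qed
    have cardZ: "card Y \<le> card Z + 2 * q"
    proof -
      have "Y = P \<union> Z" by (auto simp: P_def Z_def)
      then have "card Y \<le> card P + card Z" by (metis card_Un_le)
      then show ?thesis using \<open>card P \<le> 2 * q\<close> by simp
    qed
    (* The size of Q i after this step. *)
    define s where "s i = (2 * T (l i)) ^ (m - Suc j) * T (l i)" for i
    have s0: "0 < s i" for i using T(4) by (simp add: s_def)
    have cardQs: "card (Q i) = 2 * T (l i) * s i" if "i < j" for i
    proof -
      have "m - j = Suc (m - Suc j)" using jm by simp
      then show ?thesis using cardQ[OF that] by (simp add: s_def)
    qed
    (* Vertices that would make Q i shrink too much are not admitted to the new clique. *)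
    define X where "X i = {v \<in> Y. card {x \<in> Q i. c {x, v} \<noteq> a} < s i}" for i
    have X: "D * card (X i) \<le> 2 * n" if "i < j" for i
      unfolding X_def using finQ[OF that] cardQs[OF that] s0 finY stable[OF that]
      by (rule few_vertices_with_few_nonneighbours)
    define P' where "P' = P - (\<Union>i<j. X i)"
    have "q \<le> 2 * card P'"
    proof -
      have "D * card (\<Union>i<j. X i) \<le> D * (\<Sum>i<j. card (X i))"
        by (intro mult_le_mono2 card_UN_le) simp
      also have "\<dots> = (\<Sum>i<j. D * card (X i))" by (simp add: sum_distrib_left)
      also have "\<dots> \<le> (\<Sum>i<j. 2 * n)" using X by (intro sum_mono) simp
      also have "\<dots> \<le> 2 * m * n" using jm by simp
      finally have "2 * (D * card (\<Union>i<j. X i)) \<le> 2 * (2 * m * n)" by (rule mult_le_mono2)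
      also have "\<dots> \<le> D * q" using q(3) by simp
      finally have "D * (2 * card (\<Union>i<j. X i)) \<le> D * q" by (simp only: mult.left_commute)
      then have "2 * card (\<Union>i<j. X i) \<le> q" using D0 by simp
      moreover have "card P \<le> card P' + card (\<Union>i<j. X i)"
        unfolding P'_def using diff_card_le_card_Diff[of "\<Union>i<j. X i" P] finY by (simp add: X_def)
      ultimately show ?thesis using P(2) by simp
    qed
    moreover have "P' \<subseteq> A" using P Y by (auto simp: P'_def)
    ultimately obtain C where C: "C \<subseteq> P'" "card C = T D * 2 ^ (m * T D)"
      "clique C {e. c e = a}" "same_block b C"
      using rich[of P'] by (auto simp: T_def)
    have CP: "C \<subseteq> P" using C(1) by (auto simp: P'_def)
    have finC: "finite C" using finite_subset[OF CP] finite_subset[OF P(1) finY] by simp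
    define U where "U = (\<Union>i<j. Q i)"
    have finU: "finite U" using finQ by (simp add: U_def)
    have "card U \<le> (\<Sum>i<j. card (Q i))" unfolding U_def by (rule card_UN_le) simp
    also have "\<dots> \<le> (\<Sum>i<j. T D)"
    proof (rule sum_mono)
      fix i assume "i \<in> {..<j}"
      then have "card (Q i) \<le> T (Suc (l i))" "Suc (l i) \<le> D"
        using cardQ size_le l by (auto simp: Suc_le_eq)
      then show "card (Q i) \<le> T D" using monoD[OF T(1)] order_trans by blast
    qed
    also have "\<dots> \<le> m * T D" using jm by simp
    finally have cardU: "card U \<le> m * T D" .
    (* Among the vertices of C many have the same non-a-neighbours in all previous cliques; to these
       common non-neighbours the previous cliques are restricted. *)
    define \<pi> where "\<pi> v = {x \<in> U. c {x, v} \<noteq> a}" for v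
    obtain p where p: "p \<in> Pow U" "card C \<le> card (\<pi> -` {p} \<inter> C) * card (Pow U)"
      using pigeonhole_card[of \<pi> C "Pow U"] finC finU by (auto simp: \<pi>_def)
    define C' where "C' = \<pi> -` {p} \<inter> C"
    have C': "C' \<subseteq> C" "\<And>v. v \<in> C' \<Longrightarrow> \<pi> v = p" by (auto simp: C'_def)
    have "T D * 2 ^ (m * T D) \<le> card C' * 2 ^ card U"
      using p(2) finU C(2) by (simp add: C'_def card_Pow)
    also have "\<dots> \<le> card C' * 2 ^ (m * T D)" using cardU by simp
    finally have cardC': "T D \<le> card C'" by simp
    then obtain v0 where v0: "v0 \<in> C'" using T(4)[of D] by fastforce
    have "\<exists>Q'\<subseteq>p \<inter> Q i. card Q' = s i" if "i < j" for i
    proof -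
      have "v0 \<in> Y" "v0 \<notin> X i" using v0 C'(1) C(1) P(1) that by (auto simp: P'_def)
      then have "s i \<le> card {x \<in> Q i. c {x, v0} \<noteq> a}" by (simp add: X_def)
      also have "{x \<in> Q i. c {x, v0} \<noteq> a} = p \<inter> Q i"
        using that C'(2)[OF v0] by (auto simp: \<pi>_def U_def)
      finally show ?thesis by (meson obtain_subset_with_card_n)
    qed
    then obtain Q' where Q': "\<And>i. i < j \<Longrightarrow> Q' i \<subseteq> p \<inter> Q i \<and> card (Q' i) = s i" by metis
    have pC': "c {x, v} \<noteq> a" if "x \<in> p" "v \<in> C'" for x v
      using that C'(2)[OF that(2)] by (auto simp: \<pi>_def)
    define f where "f R = card (common_nbrs c a Z R)" for R
    have f_less: "f R < n" if R: "R \<subseteq> C'" "T 0 \<le> card R" for R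
    proof -
      from R obtain S where S: "S \<subseteq> R" "card S = m"
        using obtain_subset_with_card_n[of m R] t T(2) by auto
      then have SC: "S \<subseteq> C" using R(1) C'(1) by blast
      have SP: "x \<in> P" if "x \<in> S" for x using that SC C(1) by (auto simp: P'_def)
      have "common_nbrs c a Z R \<subseteq> common_nbrs c a {v \<in> A. \<forall>x\<in>S. b x < b v} S"
        using S(1) SP Y(1) by (auto simp: common_nbrs_def Z_def P_def dest: order.strict_trans1)
      then have "f R \<le> card (common_nbrs c a {v \<in> A. \<forall>x\<in>S. b x < b v} S)"
        unfolding f_def using A(1) by (intro card_mono) (auto simp: common_nbrs_def)
      also have "\<dots> < n"
      proof (rule book)
        show "S \<subseteq> A" using SP P(1) Y(1) by blast
      qed (use S(2) smaller_clique[OF C(3) SC] same_block_subset[OF C(4) SC] in simp_all)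
      finally show "f R < n" .
    qed
    (* Stability with respect to Z costs at most n vertices of Z, counted once and for all. *)
    have "\<exists>i<D. \<exists>R\<subseteq>C'. T (Suc i) \<le> card R \<and> (\<forall>R'\<subseteq>R. T i \<le> card R' \<longrightarrow> D * f R' \<le> D * f R + n)"
      using f_less by (rule ex_stable_subset[OF D0 T(1) cardC'])
    then obtain i0 R where R: "i0 < D" "R \<subseteq> C'" "T (Suc i0) \<le> card R"
      "\<And>R'. R' \<subseteq> R \<Longrightarrow> T i0 \<le> card R' \<Longrightarrow> D * f R' \<le> D * f R + n" by blast
    obtain R2 where R2: "R2 \<subseteq> R" "card R2 = (2 * T i0) ^ (m - Suc j) * T i0"
      using obtain_subset_with_card_n[OF order_trans[OF size_le R(3)]] by blast
    have fR: "f R < n"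
      using f_less R(2,3) monoD[OF T(1), of 0 "Suc i0"] by simp
    define Y' where "Y' = Z - common_nbrs c a Z R"
    have ZY: "Z \<subseteq> Y" and Y'Z: "Y' \<subseteq> Z" by (auto simp: Z_def Y'_def)
    have finZ: "finite Z" using ZY finY finite_subset by blast
    have cardY': "card Y \<le> card Y' + (n + 2 * q)"
    proof -
      have "card Z = card Y' + f R"
        unfolding Y'_def f_def using finZ
        by (subst card_Diff_subset) (auto simp: common_nbrs_def card_mono)
      then show ?thesis using cardZ fR by simp
    qed
    have R2C: "R2 \<subseteq> C" and R2C': "R2 \<subseteq> C'" using R2(1) R(2) C'(1) by auto
    have R2P: "R2 \<subseteq> P" using R2C C(1) by (auto simp: P'_def)
    (* The common a-neighbours of R have left Y', so those of a subset R' in Y' are exactly the ones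
       that R' has gained over R. *)
    have stable': "D * card (common_nbrs c a Y' R') \<le> n" if "R' \<subseteq> R2" "T i0 \<le> card R'" for R'
    proof -
      have "R' \<subseteq> R" using that(1) R2(1) by blast
      then have sub: "common_nbrs c a Z R \<subseteq> common_nbrs c a Z R'" by (auto simp: common_nbrs_def)
      have "common_nbrs c a Y' R' = common_nbrs c a Z R' - common_nbrs c a Z R"
        by (auto simp: common_nbrs_def Y'_def)
      also have "card \<dots> = f R' - f R"
        unfolding f_def using sub finZ by (intro card_Diff_subset) (auto simp: common_nbrs_def)
      finally show ?thesis
        using R(4)[OF \<open>R' \<subseteq> R\<close> that(2)] by (simp add: diff_mult_distrib2)
    qed
    have RY: "R2 \<subseteq> Y" using R2P P(1) by blast
    have Q'Q: "Q' i \<subseteq> Q i" "Q' i \<subseteq> p" if "i < j" for i using Q'[OF that] by auto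
    have old: "Q' i \<subseteq> A \<and> clique (Q' i) {e. c e = a} \<and> same_block b (Q' i) \<and>
        (\<forall>x\<in>Q' i. \<forall>y\<in>Y'. b x < b y) \<and> l i < D \<and>
        card (Q' i) = (2 * T (l i)) ^ (m - Suc j) * T (l i) \<and>
        (\<forall>P\<subseteq>Q' i. T (l i) \<le> card P \<longrightarrow> D * card (common_nbrs c a Y' P) \<le> n)" if i: "i < j" for i
    proof (intro conjI ballI allI impI)
      show "Q' i \<subseteq> A" using Q'Q(1)[OF i] Q[OF i] by blast
      show "clique (Q' i) {e. c e = a}" using Q'Q(1)[OF i] Q[OF i] smaller_clique by blast
      show "same_block b (Q' i)" using Q'Q(1)[OF i] Q[OF i] same_block_subset by blast
      show "b x < b y" if "x \<in> Q' i" "y \<in> Y'" for x y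
        using QY[OF i] that Q'Q(1)[OF i] Y'Z ZY by blast
      show "l i < D" by (rule l[OF i])
      show "card (Q' i) = (2 * T (l i)) ^ (m - Suc j) * T (l i)" using Q'[OF i] by (simp add: s_def)
      show "D * card (common_nbrs c a Y' B) \<le> n" if "B \<subseteq> Q' i" "T (l i) \<le> card B" for B
      proof -
        have "card (common_nbrs c a Y' B) \<le> card (common_nbrs c a Y B)"
          using finY Y'Z ZY by (intro card_mono) (auto simp: common_nbrs_def)
        then have "D * card (common_nbrs c a Y' B) \<le> D * card (common_nbrs c a Y B)" by simp
        also have "\<dots> \<le> n" using stable[OF i _ that(2)] that(1) Q'Q(1)[OF i] by blast
        finally show ?thesis .
      qed
    qed
    have new: "R2 \<subseteq> A \<and> clique R2 {e. c e = a} \<and> same_block b R2 \<and>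
        (\<forall>x\<in>R2. \<forall>y\<in>Y'. b x < b y) \<and> i0 < D \<and>
        card R2 = (2 * T i0) ^ (m - Suc j) * T i0 \<and>
        (\<forall>P\<subseteq>R2. T i0 \<le> card P \<longrightarrow> D * card (common_nbrs c a Y' P) \<le> n)"
    proof (intro conjI ballI allI impI)
      show "R2 \<subseteq> A" using RY Y(1) by blast
      show "clique R2 {e. c e = a}" using C(3) R2C smaller_clique by blast
      show "same_block b R2" using C(4) R2C same_block_subset by blast
      show "b x < b y" if "x \<in> R2" "y \<in> Y'" for x y
        using that R2P Y'Z by (force simp: P_def Z_def)
      show "i0 < D" by (rule R(1))
      show "card R2 = (2 * T i0) ^ (m - Suc j) * T i0" by (rule R2(2))
    qed (use stable' in blast)
    have cross_new: "b x < b y \<and> c {x, y} \<noteq> a" if "i < j" "x \<in> Q' i" "y \<in> R2" for i x y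
      using QY[OF that(1)] pC' that Q'Q[OF that(1)] RY R2C' by blast
    show ?case
      unfolding inv_def
    proof (intro exI[of _ "\<lambda>i. if i < j then Q' i else R2"] exI[of _ "\<lambda>i. if i < j then l i else i0"]
        exI[of _ Y'] conjI)
      show "Y' \<subseteq> A" using Y'Z ZY Y(1) by blast
      show "m * n \<le> card Y' + Suc j * (n + 2 * q)" using Y(2) cardY' by simp
      show "\<forall>i' i. i < i' \<longrightarrow> i' < Suc j \<longrightarrow> (\<forall>x\<in>if i < j then Q' i else R2.
          \<forall>y\<in>if i' < j then Q' i' else R2. b x < b y \<and> c {x, y} \<noteq> a)"
      proof (intro allI impI)
        fix i' i assume "i < i'" "i' < Suc j"
        then have "i < j" by simp
        show "\<forall>x\<in>if i < j then Q' i else R2. \<forall>y\<in>if i' < j then Q' i' else R2. b x < b y \<and> c {x, y} \<noteq> a"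
          using \<open>i < j\<close> \<open>i < i'\<close> cross_new[OF \<open>i < j\<close>] QQ[of i i'] Q'Q(1)[OF \<open>i < j\<close>] Q'Q(1)[of i']
          by (cases "i' < j") (simp_all, blast)
      qed
    qed (use old new in simp)
  qed
  from this[OF order_refl] obtain Q l Y where inv: "inv m Q l Y" by blast
  note parts = inv[unfolded inv_def, THEN conjunct2, THEN conjunct2]
  have QQ: "b x < b y \<and> c {x, y} \<noteq> a" if "i < i'" "i' < m" "x \<in> Q i" "y \<in> Q i'" for i i' x y
    using parts[THEN conjunct2] that by metis
  have Q: "Q i \<subseteq> A \<and> clique (Q i) {e. c e = a} \<and> same_block b (Q i) \<and> card (Q i) = T (l i)"
    if "i < m" for i
    using parts[THEN conjunct1, THEN spec, THEN mp, OF that] by simp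
  have "\<exists>S\<subseteq>Q i. card S = t" if "i < m" for i
  proof -
    have "T 0 \<le> T (l i)" using T(1) by (simp add: monoD)
    then have "t \<le> card (Q i)" using Q[OF that] T(2) by simp
    then show ?thesis by (meson obtain_subset_with_card_n)
  qed
  then obtain S where S: "\<And>i. i < m \<Longrightarrow> S i \<subseteq> Q i \<and> card (S i) = t" by metis
  show ?thesis
  proof (rule that[of S])
    show "S i \<subseteq> A \<and> card (S i) = t \<and> clique (S i) {e. c e = a} \<and> same_block b (S i)" if "i < m" for i
      using S[OF that] Q[OF that] smaller_clique same_block_subset by blast
    show "b x < b y \<and> c {x, y} \<noteq> a" if "i < j" "j < m" "x \<in> S i" "y \<in> S j" for i j x y
    proof -
      have "x \<in> Q i" "y \<in> Q j" using S[of i] S[of j] that by auto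
      then show ?thesis by (rule QQ[OF that(1,2)])
    qed
  qed
qed

section \<open>The bound\<close>

text \<open>
  The size \<open>t\<close> of the cliques in the chain is dictated by \<open>card_less_if_few_common_neighbours\<close>.  The
  number \<open>q \<approx> n / (2 m)\<close> serves both as the length of a block and as the size of the initial segments
  in \<open>clique_chain\<close>; as \<open>n \<le> 4 m q\<close>, the spine has at most \<open>8 m\<^sup>2 + 1\<close> blocks, and \<open>D = 16 m\<^sup>2\<close> is
  large enough.
\<close>

lemma host_arrows_book:
  fixes m :: nat
  assumes m: "2 \<le> m"
  shows "\<exists>n0. \<forall>n\<ge>n0. \<exists>L. eo_arrows (host L (2 * m * n) (2 ^ (m + 1) * n)) (book m n) (book m n)"
proof -
  define t where "t = 2 ^ (m + 4) * m\<^sup>2"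
  define D where "D = 16 * m\<^sup>2"
  (* The second factor of K bounds the number of patterns in the pigeonhole step of the chain. *)
  define K where "K = threshold m t D * 2 ^ (m * threshold m t D)"
  have "m * 1 \<le> m\<^sup>2 * 2 ^ (m + 4)"
    unfolding power2_eq_square using m by (intro mult_le_mono) auto
  then have mt: "m \<le> t" by (simp add: t_def mult.commute)
  have "0 < t" using mt m by linarith
  then have "0 < threshold m t D" by (rule threshold_pos)
  then have K: "0 < K" unfolding K_def by (intro mult_pos_pos zero_less_power) simp_all
  have p: "0 < 8 * m\<^sup>2" using m by simp
  obtain q0 where
    rich: "\<And>q M (b :: nat \<Rightarrow> nat) (c :: nat set \<Rightarrow> colour). q0 \<le> q \<Longrightarrow> M \<le> 8 * m\<^sup>2 * q \<Longrightarrow>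
      \<forall>x<M. b x < 8 * m\<^sup>2 + 1 \<Longrightarrow>
      \<exists>a A. A \<subseteq> {..<M} \<and> M \<le> 2 * card A \<and> (\<forall>Y\<subseteq>A. q \<le> 2 * card Y \<longrightarrow>
          (\<exists>Q\<subseteq>Y. card Q = K \<and> clique Q {e. c e = a} \<and> same_block b Q))"
    using ex_clique_rich_half[OF p K, of "8 * m\<^sup>2 + 1"] by metis
  show ?thesis
  proof (rule exI[of _ "2 * m * (q0 + 1)"], intro allI impI)
    fix n assume n0: "2 * m * (q0 + 1) \<le> n"
    define q where "q = n div (2 * m)"
    define M where "M = 2 * m * n"
    define N where "N = 2 ^ (m + 1) * n"
    define b where "b = (\<lambda>x. x div q)"
    have "q0 + 1 \<le> q"
      unfolding q_def using n0 m by (simp add: less_eq_div_iff_mult_less_eq mult.commute)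
    then have q: "q0 \<le> q" "0 < q" by simp_all
    have mq: "2 * m * q \<le> n" by (simp add: q_def)
    have "n < 2 * m * q + 2 * m"
      using m dividend_less_times_div[of "2 * m" n] by (simp add: q_def)
    moreover have "2 * m \<le> 2 * m * q" using q(2) by simp
    ultimately have nq: "n \<le> 4 * m * q" by linarith
    have n: "0 < n" using mq m q(2) by (metis gr0I le_zero_eq mult_is_0 not_numeral_le_zero zero_neq_numeral)
    have Mq: "M \<le> 8 * m\<^sup>2 * q"
      using mult_le_mono2[OF nq, of "2 * m"] by (simp add: M_def power2_eq_square mult_ac)
    have b_less: "\<forall>x<M. b x < 8 * m\<^sup>2 + 1"
    proof (intro allI impI)
      fix x assume "x < M"
      then have "x div q \<le> (8 * m\<^sup>2 * q) div q" using Mq by (intro div_le_mono) simp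
      then show "b x < 8 * m\<^sup>2 + 1" using q(2) by (simp add: b_def)
    qed
    have "eo_arrows (host q M N) (book m n) (book m n)"
      unfolding eo_arrows_def
    proof (intro allI, rule ccontr)
      fix c :: "nat set \<Rightarrow> colour"
      assume neg: "\<not> ((\<exists>C. eo_copy (book m n) (host q M N) C \<and> (\<forall>e\<in>edges C. c e = Red)) \<or>
          (\<exists>C. eo_copy (book m n) (host q M N) C \<and> (\<forall>e\<in>edges C. c e = Blue)))"
      have no_book: "\<not> (\<exists>C. eo_copy (book m n) (host q M N) C \<and> (\<forall>e\<in>edges C. c e = a))" for a
        using neg by (cases a) simp_all
      have few_pages: "card (common_nbrs c a {M..<M + N} S) < n"
        if "S \<subseteq> {..<M}" "card S = m" "same_block b S \<or> inj_on b S" "clique S {e. c e = a}" for a S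
      proof (rule ccontr)
        assume "\<not> ?thesis"
        then have "\<exists>C. eo_copy (book m n) (host q M N) C \<and> (\<forall>e\<in>edges C. c e = a)"
          using that unfolding b_def
          by (intro monochromatic_book_in_host[where W = "common_nbrs c a {M..<M + N} S"])
            (auto simp: common_nbrs_def)
        with no_book show False by blast
      qed
      have few_later: "card (common_nbrs c a {v \<in> {..<M}. \<forall>x\<in>S. b x < b v} S) < n"
        if "S \<subseteq> {..<M}" "card S = m" "same_block b S" "clique S {e. c e = a}" for a S
      proof (rule ccontr)
        assume "\<not> ?thesis"
        then have "\<exists>C. eo_copy (book m n) (host q M N) C \<and> (\<forall>e\<in>edges C. c e = a)"
          using that unfolding b_def
          by (intro monochromatic_book_in_host[where W = "common_nbrs c a {v \<in> {..<M}. \<forall>x\<in>S. b x < b v} S"])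
            (auto simp: common_nbrs_def b_def)
        with no_book show False by blast
      qed
      obtain a A where A: "A \<subseteq> {..<M}" "M \<le> 2 * card A"
        and A_rich: "\<And>Y. Y \<subseteq> A \<Longrightarrow> q \<le> 2 * card Y \<Longrightarrow>
          \<exists>Q\<subseteq>Y. card Q = K \<and> clique Q {e. c e = a} \<and> same_block b Q"
        using rich[OF q(1) Mq b_less, of c] by blast
      have finA: "finite A" using A(1) finite_subset by blast
      obtain Q where
        Q: "\<And>i. i < m \<Longrightarrow> Q i \<subseteq> A \<and> card (Q i) = t \<and> clique (Q i) {e. c e = a} \<and> same_block b (Q i)"
        and QQ: "\<And>i j x y. i < j \<Longrightarrow> j < m \<Longrightarrow> x \<in> Q i \<Longrightarrow> y \<in> Q j \<Longrightarrow> b x < b y \<and> c {x, y} \<noteq> a"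
      proof (rule clique_chain[of A m n b q D t c a])
        note found = that
        show thesis
          if "\<And>i. i < m \<Longrightarrow> Q i \<subseteq> A \<and> card (Q i) = t \<and> clique (Q i) {e. c e = a} \<and> same_block b (Q i)"
            "\<And>i j x y. i < j \<Longrightarrow> j < m \<Longrightarrow> x \<in> Q i \<Longrightarrow> y \<in> Q j \<Longrightarrow> b x < b y \<and> c {x, y} \<noteq> a" for Q
          by (rule found[OF that])
        show "m * n \<le> card A" using A(2) by (simp add: M_def)
        show "card {x \<in> A. b x = \<beta>} \<le> q" for \<beta>
        proof -
          have "{x \<in> A. b x = \<beta>} \<subseteq> {\<beta> * q..<\<beta> * q + q}"
            using q(2) by (auto simp: b_def dividend_less_times_div mult.commute)
              (metis dividend_less_div_times add.commute mult.commute)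
          then have "card {x \<in> A. b x = \<beta>} \<le> card {\<beta> * q..<\<beta> * q + q}"
            by (intro card_mono) simp_all
          then show ?thesis by simp
        qed
        show "4 * m * n \<le> D * q"
          using mult_le_mono2[OF nq, of "4 * m"] by (simp add: D_def power2_eq_square mult_ac)
        show "card (common_nbrs c a {v \<in> A. \<forall>x\<in>S. b x < b v} S) < n"
          if S: "S \<subseteq> A" "card S = m" "same_block b S" "clique S {e. c e = a}" for S
        proof -
          have "card (common_nbrs c a {v \<in> A. \<forall>x\<in>S. b x < b v} S) \<le>
              card (common_nbrs c a {v \<in> {..<M}. \<forall>x\<in>S. b x < b v} S)"
            using A(1) by (intro card_mono) (auto simp: common_nbrs_def)
          also have "\<dots> < n" using S A(1) by (intro few_later) auto
          finally show ?thesis .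
        qed
        show "\<exists>Q\<subseteq>Y. card Q = threshold m t D * 2 ^ (m * threshold m t D) \<and>
            clique Q {e. c e = a} \<and> same_block b Q" if "Y \<subseteq> A" "q \<le> 2 * card Y" for Y
          using A_rich[OF that] by (simp add: K_def)
      qed (use finA q mq mt m in simp_all)
      (* The cliques have colour a, the edges between them the other colour a'. *)
      obtain a' where a': "\<And>e. c e \<noteq> a \<Longrightarrow> c e = a'"
        by (cases a) (metis colour.exhaust)+
      have "card {M..<M + N} < 2 ^ (m + 1) * n"
      proof (rule card_less_if_few_common_neighbours[where Q = Q and t = t and R = "\<lambda>x v. c {x, v} = a"])
        show "2 ^ (m + 3) * m\<^sup>2 < t" using m by (simp add: t_def power_add)
        show "finite (Q i) \<and> card (Q i) = t" if "i < m" for i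
          using Q[OF that] finA finite_subset by blast
        show "card {v \<in> {M..<M + N}. \<forall>x\<in>S. c {x, v} = a} \<le> n" if "i < m" "S \<subseteq> Q i" "card S = m" for i S
        proof -
          have "card (common_nbrs c a {M..<M + N} S) < n"
          proof (rule few_pages)
            show "S \<subseteq> {..<M}" using Q[OF that(1)] that(2) A(1) by blast
            show "same_block b S \<or> inj_on b S" using Q[OF that(1)] that(2) same_block_subset by blast
            show "clique S {e. c e = a}" using Q[OF that(1)] that(2) smaller_clique by blast
          qed (rule that(3))
          then show ?thesis by (simp add: common_nbrs_def)
        qed
        show "card {v \<in> {M..<M + N}. \<forall>i<m. c {f i, v} \<noteq> a} \<le> n" if f: "f \<in> (\<Pi>\<^sub>E i\<in>{..<m}. Q i)" for f
        proof -
          have fQ: "f i \<in> Q i" if "i < m" for i using f that by auto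
          have incr: "b (f i) < b (f j) \<and> c {f i, f j} \<noteq> a" if "i < j" "j < m" for i j
            using QQ[OF that fQ fQ] that by simp
          have ne: "b (f i) \<noteq> b (f j) \<and> c {f i, f j} = a'" if "i \<noteq> j" "i < m" "j < m" for i j
            using incr[of i j] incr[of j i] a' that
            by (cases i j rule: linorder_cases) (auto simp: insert_commute)
          have inj: "inj_on f {..<m}" using ne by (metis inj_onI lessThan_iff)
          have "card (common_nbrs c a' {M..<M + N} (f ` {..<m})) < n"
          proof (rule few_pages)
            have "f i \<in> {..<M}" if "i < m" for i using fQ[OF that] Q[OF that] A(1) by blast
            then show "f ` {..<m} \<subseteq> {..<M}" by auto
            show "card (f ` {..<m}) = m" using card_image[OF inj] by simp
            have "inj_on b (f ` {..<m})"
            proof (rule inj_onI)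
              fix x y assume "x \<in> f ` {..<m}" "y \<in> f ` {..<m}" "b x = b y"
              then obtain i j where "i < m" "x = f i" "j < m" "y = f j" "b (f i) = b (f j)" by auto
              then show "x = y" using ne[of i j] by (cases "i = j") simp_all
            qed
            then show "same_block b (f ` {..<m}) \<or> inj_on b (f ` {..<m})" ..
            show "clique (f ` {..<m}) {e. c e = a'}"
              unfolding clique_def
            proof (intro ballI impI)
              fix x y assume "x \<in> f ` {..<m}" "y \<in> f ` {..<m}" "x \<noteq> y"
              then obtain i j where "i < m" "x = f i" "j < m" "y = f j" "i \<noteq> j" by auto
              then show "{x, y} \<in> {e. c e = a'}" using ne[of i j] by simp
            qed
          qed
          moreover have "{v \<in> {M..<M + N}. \<forall>i<m. c {f i, v} \<noteq> a} \<subseteq> common_nbrs c a' {M..<M + N} (f ` {..<m})"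
            using a' by (auto simp: common_nbrs_def)
          then have "card {v \<in> {M..<M + N}. \<forall>i<m. c {f i, v} \<noteq> a} \<le>
              card (common_nbrs c a' {M..<M + N} (f ` {..<m}))"
            by (rule card_mono[rotated]) (simp add: common_nbrs_def)
          ultimately show ?thesis by simp
        qed
      qed (use m n in simp_all)
      then show False by (simp add: N_def)
    qed
    then show "\<exists>L. eo_arrows (host L (2 * m * n) (2 ^ (m + 1) * n)) (book m n) (book m n)"
      unfolding M_def N_def by blast
  qed
qed

lemma card_edges_host_eq:
  assumes "0 < m"
  shows "card (edges (host L (2 * m * n) (2 ^ (m + 1) * n))) =
    (2 * m\<^sup>2 + m * 2 ^ (m + 2)) * n\<^sup>2 - m * n"
proof -
  have "2 * m * n * (2 * m * n - 1) div 2 = m * n * (2 * m * n - 1)" by (simp add: mult.assoc)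
  also have "\<dots> = 2 * m\<^sup>2 * n\<^sup>2 - m * n"
    by (simp add: diff_mult_distrib2 power2_eq_square mult_ac)
  finally have "card (edges (host L (2 * m * n) (2 ^ (m + 1) * n))) =
      2 * m\<^sup>2 * n\<^sup>2 - m * n + m * 2 ^ (m + 2) * n\<^sup>2"
    unfolding card_edges_host by (simp add: power2_eq_square mult_ac)
  moreover have "m * n \<le> (m * n) * (2 * (m * n))" by (cases "m * n") simp_all
  then have "m * n \<le> 2 * m\<^sup>2 * n\<^sup>2" by (simp add: power2_eq_square mult_ac)
  ultimately show ?thesis by (simp add: distrib_right)
qed

theorem theorem2p5:
  fixes m :: nat
  assumes "m \<ge> 2"
  shows "\<exists>n\<^sub>0::nat. \<forall>n\<ge>n\<^sub>0.
           size_eo_ramsey_diag (book m n)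
             \<le> enat ((2 * m\<^sup>2 + m * 2 ^ (m + 2)) * n\<^sup>2 - m * n)"
proof -
  obtain n0 where n0: "\<And>n. n0 \<le> n \<Longrightarrow>
      \<exists>L. eo_arrows (host L (2 * m * n) (2 ^ (m + 1) * n)) (book m n) (book m n)"
    using host_arrows_book[OF assms] by blast
  show ?thesis
  proof (intro exI[of _ n0] allI impI)
    fix n assume "n0 \<le> n"
    then obtain L where "eo_arrows (host L (2 * m * n) (2 ^ (m + 1) * n)) (book m n) (book m n)"
      using n0 by blast
    moreover have "card (edges (host L (2 * m * n) (2 ^ (m + 1) * n))) =
        (2 * m\<^sup>2 + m * 2 ^ (m + 2)) * n\<^sup>2 - m * n"
      using assms by (intro card_edges_host_eq) simp
    ultimately show "size_eo_ramsey_diag (book m n)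
        \<le> enat ((2 * m\<^sup>2 + m * 2 ^ (m + 2)) * n\<^sup>2 - m * n)"
      unfolding size_eo_ramsey_def using edge_ordered_graph_host by (intro Inf_lower) blast
  qed
qed

end
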